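(* Let $1\le m\le n$, let $\mathcal F\subsetneq[P_{n+l-1}]_{\ge l}$ be a lower filter, and let $\mathcal F^{\mathsf c}:=[P_{n+l-1}]_{\ge l}\setminus\mathcal F$ be its complement. Then $G_{l,m,\mathcal F}$ is a Gröbner basis of $J_{l,m,\mathcal F^{\mathsf c}}$ with respect to the lexicographic order with $x_1<\cdots<x_n$. Hence $J_{l,m,\mathcal F^{\mathsf c}}=I_{l,m,\mathcal F}$, and $I_{l,m,\mathcal F}$ is a radical ideal.
   Context: $K$ is an infinite field, $n,l\ge 1$ are integers, $S=K[x_1,\ldots,x_n]$. $P_m$ (for any positive integer $m$) is the set of partitions of $m$ (non-increasing sequences of positive integers with sum $m$). The dominance order: for $\lambda=(\lambda_1,\ldots,\lambda_p)$, $\mu=(\mu_1,\ldots,\mu_q)$ partitions of the same integer, $\lambda\unrhd\mu$ (equivalently $\mu\unlhd\lambda$) iff $\lambda_1+\cdots+\lambda_i\ge\mu_1+\cdots+\mu_i$ for $1\le i\le\min\{p,q\}$. $[P_{n+l-1}]_{\ge l}:=\{\lambda\in P_{n+l-1}\mid \lambda_1\ge l\}$. A subset $\mathcal F\subset[P_{n+l-1}]_{\ge l}$ is a lower (resp. upper) filter if $\lambda\in\mathcal F$, $\mu\in[P_{n+l-1}]_{\ge l}$ and $\mu\unlhd\lambda$ (resp. $\mu\unrhd\lambda$) imply $\mu\in\mathcal F$. For $\lambda\in[P_{n+l-1}]_{\ge l}$, $\mathrm{Tab}(l,\lambda)$ is the set of bijective fillings $T$ of the squares of the Young diagram of $\lambda$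 by the multiset consisting of $l$ copies of $1$ and one copy of each of $2,\ldots,n$, such that no two copies of $1$ lie in the same column. If $a_1,\ldots,a_r$ are the entries of a column from top to bottom, its difference product is $\prod_{1\le i<j\le r}(x_{a_i}-x_{a_j})$; the Specht polynomial $f_T$ is the product of the difference products of all columns of $T$. Fix an integer $m$ with $1\le m\le n$ and set $\Delta_m:=\prod_{1\le i<j\le m}(x_i-x_j)$. For $T\in\mathrm{Tab}(l,\lambda)$ set $f_{m,T}:=\operatorname{lcm}\{f_T,\Delta_m\}\in S$. For a lower filter $\mathcal F$, $G_{l,m,\mathcal F}:=\{f_{m,T}\mid T\in\mathrm{Tab}(l,\lambda),\ \lambda\in\mathcal F\}$ and $I_{l,m,\mathcal F}$ is the ideal of $S$ generated by $G_{l,m,\mathcal F}$. For $\mathbf a=(a_1,\ldots,a_n)\in K^n$, $\Lambda_l(\mathbf a)\in[P_{n+l-1}]_{\ge l}$ is the partition of $n+l-1$ whose parts are the multiplicities of the distinct values in the sequence $(a_1,\ldots,a_1,a_2,\ldots,a_n)$ in which $a_1$ is written $l$ times. For an upper filter $\mathcal F'$, $J_{l,\mathcal F'}$ is the ideal of all $f\in S$ with $f(\mathbf a)=0$ for every $\mathbf a\in K^n$ with $\Lambda_l(\mathbf a)\in\mathcal F'$, and $J_{l,m,\mathcal F'}:=(\Delta_m)\cap J_{l,\mathcal F'}$. *)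

theory Defs
  imports
    "HOL-Algebra.Ideal"
    "HOL-Algebra.Divisibility"
    "HOL-Library.Poly_Mapping"
    "HOL-Library.Multiset"
    "HOL-Library.FuncSet"
begin

section \<open>Partitions\<close>

definition partitions :: "nat \<Rightarrow> nat list set" where
  "partitions N = {\<nu>. sorted_wrt (\<ge>) \<nu> \<and> (\<forall>p\<in>set \<nu>. 0 < p) \<and> sum_list \<nu> = N}"

definition dominates :: "nat list \<Rightarrow> nat list \<Rightarrow> bool" where
  "dominates \<nu> \<mu> \<longleftrightarrow>
     (\<forall>i\<in>{1..min (length \<nu>) (length \<mu>)}. sum_list (take i \<nu>) \<ge> sum_list (take i \<mu>))"

text \<open>The head of a partition is its largest part; the definition is used with \<open>N \<ge> 1\<close> only,
  so that partitions of \<open>N\<close> are nonempty lists.\<close>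
definition partitions_ge :: "nat \<Rightarrow> nat \<Rightarrow> nat list set" where
  "partitions_ge N l = {\<nu> \<in> partitions N. hd \<nu> \<ge> l}"

definition lower_filter :: "nat \<Rightarrow> nat \<Rightarrow> nat list set \<Rightarrow> bool" where
  "lower_filter N l F \<longleftrightarrow> F \<subseteq> partitions_ge N l \<and>
     (\<forall>\<nu>\<in>F. \<forall>\<mu>\<in>partitions_ge N l. dominates \<nu> \<mu> \<longrightarrow> \<mu> \<in> F)"


section \<open>The polynomial ring in finitely many variables\<close>

text \<open>Monomials are finitely supported exponent vectors \<open>nat \<Rightarrow>\<^sub>0 nat\<close>, and a polynomial assigns
  coefficients to finitely many monomials. The type has infinitely many variables; the ring
  \<open>K[x\<^sub>1, \<dots>, x\<^sub>n]\<close> consists of the polynomials involving only variables with index in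
  \<open>{1..n}\<close>.\<close>
type_synonym 'k mpoly = "(nat \<Rightarrow>\<^sub>0 nat) \<Rightarrow>\<^sub>0 'k"

definition poly_ring :: "nat \<Rightarrow> 'k::field mpoly ring" where
  "poly_ring n = \<lparr>carrier = {p. \<forall>s\<in>Poly_Mapping.keys p. Poly_Mapping.keys s \<subseteq> {1..n}},
                  monoid.mult = (*), one = 1, zero = 0, add = (+)\<rparr>"

lemma cring_poly_ring: "cring (poly_ring n :: 'k::field mpoly ring)"
proof (rule cringI)
  show "abelian_group (poly_ring n :: 'k mpoly ring)"
  proof (rule abelian_groupI)
    fix p q :: "'k mpoly"
    assume "p \<in> carrier (poly_ring n)" "q \<in> carrier (poly_ring n)"
    then show "p \<oplus>\<^bsub>poly_ring n\<^esub> q \<in> carrier (poly_ring n)"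
      using keys_add[of p q] unfolding poly_ring_def by fastforce
  next
    fix p :: "'k mpoly"
    assume "p \<in> carrier (poly_ring n)"
    then have "- p \<in> carrier (poly_ring n)" and "- p \<oplus>\<^bsub>poly_ring n\<^esub> p = \<zero>\<^bsub>poly_ring n\<^esub>"
      by (auto simp: poly_ring_def)
    then show "\<exists>q\<in>carrier (poly_ring n). q \<oplus>\<^bsub>poly_ring n\<^esub> p = \<zero>\<^bsub>poly_ring n\<^esub>"
      by blast
  qed (auto simp: poly_ring_def algebra_simps)
  show "comm_monoid (poly_ring n :: 'k mpoly ring)"
  proof (rule comm_monoidI)
    fix p q :: "'k mpoly"
    assume *: "p \<in> carrier (poly_ring n)" "q \<in> carrier (poly_ring n)"
    have "Poly_Mapping.keys s \<subseteq> {1..n}" if "s \<in> Poly_Mapping.keys (p * q)" for s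
    proof -
      from keys_mult[of p q] that obtain a b
        where "s = a + b" "a \<in> Poly_Mapping.keys p" "b \<in> Poly_Mapping.keys q"
        by blast
      with * show ?thesis
        using keys_add[of a b] by (fastforce simp: poly_ring_def)
    qed
    then show "p \<otimes>\<^bsub>poly_ring n\<^esub> q \<in> carrier (poly_ring n)"
      by (auto simp: poly_ring_def)
  qed (auto simp: poly_ring_def algebra_simps)
qed (auto simp: poly_ring_def algebra_simps)

definition var :: "nat \<Rightarrow> 'k::field mpoly" where
  "var i = Poly_Mapping.single (Poly_Mapping.single i 1) 1"

definition poly_eval :: "(nat \<Rightarrow> 'k::field) \<Rightarrow> 'k mpoly \<Rightarrow> 'k" where
  "poly_eval a p =
     (\<Sum>s\<in>Poly_Mapping.keys p.
        Poly_Mapping.lookup p s *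
        (\<Prod>i\<in>Poly_Mapping.keys s. a i ^ Poly_Mapping.lookup s i))"

definition radical_ideal :: "'a set \<Rightarrow> ('a, 'b) ring_scheme \<Rightarrow> bool" where
  "radical_ideal I R \<longleftrightarrow> ideal I R \<and>
     (\<forall>f\<in>carrier R. \<forall>k::nat. 1 \<le> k \<longrightarrow> f [^]\<^bsub>R\<^esub> k \<in> I \<longrightarrow> f \<in> I)"


section \<open>Groebner bases for the lexicographic order\<close>

text \<open>Variables with larger index are larger, i.e. \<open>x\<^sub>1 < \<dots> < x\<^sub>n\<close>: the exponents of the
  largest variable on which two monomials differ decide.\<close>
definition lex_less :: "(nat \<Rightarrow>\<^sub>0 nat) \<Rightarrow> (nat \<Rightarrow>\<^sub>0 nat) \<Rightarrow> bool" where
  "lex_less s t \<longleftrightarrow>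
     (\<exists>k. Poly_Mapping.lookup s k < Poly_Mapping.lookup t k \<and>
       (\<forall>k'>k. Poly_Mapping.lookup s k' = Poly_Mapping.lookup t k'))"

definition leading_monomial :: "'k::field mpoly \<Rightarrow> (nat \<Rightarrow>\<^sub>0 nat)" where
  "leading_monomial p =
     (THE s. s \<in> Poly_Mapping.keys p \<and>
       (\<forall>t\<in>Poly_Mapping.keys p. t \<noteq> s \<longrightarrow> lex_less t s))"

definition initial_ideal :: "nat \<Rightarrow> 'k::field mpoly set \<Rightarrow> 'k mpoly set" where
  "initial_ideal n A =
     Idl\<^bsub>poly_ring n\<^esub> {Poly_Mapping.single (leading_monomial f) 1 | f. f \<in> A \<and> f \<noteq> 0}"

definition groebner_basis :: "nat \<Rightarrow> 'k::field mpoly set \<Rightarrow> 'k mpoly set \<Rightarrow> bool" where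
  "groebner_basis n G I \<longleftrightarrow>
     ideal I (poly_ring n) \<and> finite G \<and> G \<subseteq> I \<and> 0 \<notin> G \<and> initial_ideal n G = initial_ideal n I"


section \<open>Tableaux and Specht polynomials\<close>

text \<open>Squares are pairs (row, column), both counted from 0.\<close>
definition diagram :: "nat list \<Rightarrow> (nat \<times> nat) set" where
  "diagram \<nu> = {(i, j). i < length \<nu> \<and> j < \<nu> ! i}"

definition Tab :: "nat \<Rightarrow> nat \<Rightarrow> nat list \<Rightarrow> (nat \<times> nat \<Rightarrow> nat) set" where
  "Tab n l \<nu> = {T \<in> extensional (diagram \<nu>).
     image_mset T (mset_set (diagram \<nu>)) = replicate_mset l 1 + mset_set {2..n} \<and>
     (\<forall>i i' j. (i, j) \<in> diagram \<nu> \<longrightarrow> (i', j) \<in> diagram \<nu> \<longrightarrow>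
        T (i, j) = 1 \<longrightarrow> T (i', j) = 1 \<longrightarrow> i = i')}"

definition column :: "nat list \<Rightarrow> (nat \<times> nat \<Rightarrow> nat) \<Rightarrow> nat \<Rightarrow> nat list" where
  "column \<nu> T j = map (\<lambda>i. T (i, j)) (filter (\<lambda>i. (i, j) \<in> diagram \<nu>) [0..<length \<nu>])"

definition difference_product :: "nat list \<Rightarrow> 'k::field mpoly" where
  "difference_product as = (\<Prod>j<length as. \<Prod>i<j. var (as ! i) - var (as ! j))"

definition specht :: "nat list \<Rightarrow> (nat \<times> nat \<Rightarrow> nat) \<Rightarrow> 'k::field mpoly" where
  "specht \<nu> T = (\<Prod>j<hd \<nu>. difference_product (column \<nu> T j))"

definition Delta :: "nat \<Rightarrow> 'k::field mpoly" where
  "Delta m = (\<Prod>j\<in>{1..m}. \<Prod>i\<in>{1..<j}. var i - var j)"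

text \<open>The least common multiple in \<open>K[x\<^sub>1, \<dots>, x\<^sub>n]\<close> is unique up to a nonzero scalar;
  \<^const>\<open>somelcm\<close> picks one.\<close>
definition specht_lcm ::
  "nat \<Rightarrow> nat \<Rightarrow> nat list \<Rightarrow> (nat \<times> nat \<Rightarrow> nat) \<Rightarrow> 'k::field mpoly" where
  "specht_lcm n m \<nu> T = somelcm (poly_ring n) (specht \<nu> T) (Delta m)"

definition G_set :: "nat \<Rightarrow> nat \<Rightarrow> nat \<Rightarrow> nat list set \<Rightarrow> 'k::field mpoly set" where
  "G_set n l m F = {specht_lcm n m \<nu> T | \<nu> T. \<nu> \<in> F \<and> T \<in> Tab n l \<nu>}"

definition I_ideal :: "nat \<Rightarrow> nat \<Rightarrow> nat \<Rightarrow> nat list set \<Rightarrow> 'k::field mpoly set" where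
  "I_ideal n l m F = Idl\<^bsub>poly_ring n\<^esub> (G_set n l m F)"


section \<open>Vanishing ideals\<close>

definition Lambda :: "nat \<Rightarrow> nat \<Rightarrow> (nat \<Rightarrow> 'k) \<Rightarrow> nat list" where
  "Lambda n l a =
     (let ws = replicate l (a 1) @ map a [2..<Suc n]
      in rev (sort (map (count_list ws) (remdups ws))))"

definition J_ideal :: "nat \<Rightarrow> nat \<Rightarrow> nat list set \<Rightarrow> 'k::field mpoly set" where
  "J_ideal n l F' = {f \<in> carrier (poly_ring n).
     \<forall>a \<in> {1..n} \<rightarrow>\<^sub>E UNIV. Lambda n l a \<in> F' \<longrightarrow> poly_eval a f = 0}"

definition Jm_ideal :: "nat \<Rightarrow> nat \<Rightarrow> nat \<Rightarrow> nat list set \<Rightarrow> 'k::field mpoly set" where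
  "Jm_ideal n l m F' = PIdl\<^bsub>poly_ring n\<^esub> (Delta m) \<inter> J_ideal n l F'"

end

theory Submission
  imports Defs "HOL-Computational_Algebra.Polynomial"
begin

text \<open>Since \<open>K\<close> is infinite, a product of distinct linear forms \<open>x\<^sub>a - x\<^sub>b\<close> divides a
  polynomial \<open>p\<close> exactly when \<open>p\<close> vanishes at every point with \<open>\<alpha>\<^sub>a = \<alpha>\<^sub>b\<close> for one of
  these pairs (lemma \<open>diff_prod_divides\<close>). This has three consequences. The ideal
  \<open>J\<close> of the theorem consists of all polynomials that vanish on the set of points \<open>\<alpha>\<close> for which
  \<open>\<Lambda>\<^sub>l(\<alpha>)\<close> lies outside \<open>\<F>\<close> or two of \<open>\<alpha>\<^sub>1, \<dots>, \<alpha>\<^sub>m\<close> agree; in particular it is radical.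
  The least common multiple of \<open>f\<^sub>T\<close> and \<open>\<Delta>\<^sub>m\<close> is, up to a unit, the product of \<open>x\<^sub>a - x\<^sub>b\<close>
  over all pairs \<open>a < b\<close> that lie in a common column of \<open>T\<close> or satisfy \<open>b \<le> m\<close>. Finally the
  leading monomial of this product can be read off, namely the product of the \<open>x\<^sub>b\<close>.

  That \<open>f\<^sub>T\<close> vanishes where it should is a counting argument: if \<open>f\<^sub>T(\<alpha>) \<noteq> 0\<close>, then every value
  of \<open>\<alpha>\<close> occurs at most once in each column of the shape \<open>\<nu>\<close> of \<open>T\<close>, which forces
  \<open>\<Lambda>\<^sub>l(\<alpha>)\<close> to be dominated by \<open>\<nu>\<close>, so \<open>\<Lambda>\<^sub>l(\<alpha>) \<in> \<F>\<close>.

  The heart of the matter is lemma \<open>leading_monomial_divisible\<close>: the leading monomial of every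
  nonzero \<open>f \<in> J\<close> is divisible by that of some \<open>f\<^sub>m\<^sub>,\<^sub>T\<close>. It is proved by induction on \<open>n\<close>,
  starting from \<open>n = m\<close>, where \<open>\<Delta>\<^sub>n\<close> divides \<open>f\<close> and is itself the least common multiple. For
  the step, let \<open>g x\<^sub>n\<^sup>d\<close> be the leading term of \<open>f\<close> as a polynomial in its last variable.
  For a point \<open>\<alpha>\<close> in \<open>n - 1\<close> coordinates with partition \<open>\<mu>\<close>, setting \<open>x\<^sub>n\<close> to a value of
  multiplicity \<open>\<mu>\<^sub>i\<close> adds a box to the part \<open>\<mu>\<^sub>i\<close>, and adding it to a larger part gives a
  partition higher in the dominance order. Values not yet present belong to parts equal to 0, and
  there are infinitely many of them. So if \<open>\<mu>\<close> with a box added to its part number \<open>d + 1\<close>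
  is outside \<open>\<F>\<close>, then \<open>f(\<alpha>, x\<^sub>n)\<close> has more than \<open>d\<close> roots and \<open>g(\<alpha>) = 0\<close>.
  Hence \<open>g\<close> satisfies the hypotheses for the lower filter of all \<open>\<mu>\<close> such that this enlarged
  partition belongs to \<open>\<F>\<close>. By induction the leading monomial of \<open>g\<close> is divisible by that of
  some \<open>f\<^sub>m\<^sub>,\<^sub>T\<close>. Putting \<open>n\<close> into the new box of \<open>T\<close>, which has at most \<open>d\<close> boxes above it,
  multiplies this monomial by at most \<open>x\<^sub>n\<^sup>d\<close>.

  Divisibility of leading monomials yields the equality of initial ideals and, by the division
  algorithm, that the \<open>f\<^sub>m\<^sub>,\<^sub>T\<close> generate \<open>J\<close>.\<close>

section \<open>Evaluation and the polynomial ring\<close>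

abbreviation "lookup \<equiv> Poly_Mapping.lookup"
abbreviation "keys \<equiv> Poly_Mapping.keys"
abbreviation "single \<equiv> Poly_Mapping.single"

abbreviation polys :: "nat \<Rightarrow> 'k::field mpoly set" where
  "polys n \<equiv> carrier (poly_ring n)"

definition monom_eval :: "(nat \<Rightarrow> 'k::field) \<Rightarrow> (nat \<Rightarrow>\<^sub>0 nat) \<Rightarrow> 'k" where
  "monom_eval a s = (\<Prod>i\<in>keys s. a i ^ lookup s i)"

lemma monom_eval_superset:
  assumes "finite X" "keys s \<subseteq> X"
  shows "monom_eval a s = (\<Prod>i\<in>X. a i ^ lookup s i)"
  unfolding monom_eval_def using assms
  by (intro prod.mono_neutral_left) (auto simp: in_keys_iff)

lemma monom_eval_zero [simp]: "monom_eval a 0 = 1"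
  by (simp add: monom_eval_def)

lemma monom_eval_add: "monom_eval a (s + t) = monom_eval a s * monom_eval a t"
proof -
  let ?X = "keys s \<union> keys t"
  have "keys (s + t) \<subseteq> ?X" by (rule keys_add)
  then show ?thesis
    by (simp add: monom_eval_superset[of ?X] lookup_add power_add prod.distrib)
qed

lemma poly_eval_superset:
  assumes "finite X" "keys p \<subseteq> X"
  shows "poly_eval a p = (\<Sum>s\<in>X. lookup p s * monom_eval a s)"
  unfolding poly_eval_def monom_eval_def using assms
  by (intro sum.mono_neutral_left) (auto simp: in_keys_iff)

lemma poly_eval_zero [simp]: "poly_eval a 0 = 0"
  by (simp add: poly_eval_def)

lemma poly_eval_single [simp]: "poly_eval a (single s c) = c * monom_eval a s"
  by (subst poly_eval_superset[of "{s}"]) auto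

lemma poly_eval_add: "poly_eval a (p + q) = poly_eval a p + poly_eval a q"
proof -
  let ?X = "keys p \<union> keys q"
  have "keys (p + q) \<subseteq> ?X" by (rule keys_add)
  then show ?thesis
    by (simp add: poly_eval_superset[of ?X] lookup_add sum.distrib distrib_right)
qed

lemma poly_eval_sum: "poly_eval a (\<Sum>x\<in>A. g x) = (\<Sum>x\<in>A. poly_eval a (g x))"
  by (induction A rule: infinite_finite_induct) (auto simp: poly_eval_add)

lemma poly_eval_uminus: "poly_eval a (- p) = - poly_eval a p"
  using poly_eval_add[of a p "- p"] by (simp add: eq_neg_iff_add_eq_0 add.commute)

lemma poly_eval_diff: "poly_eval a (p - q) = poly_eval a p - poly_eval a q"
  using poly_eval_add[of a p "- q"] by (simp add: poly_eval_uminus)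

lemma poly_as_sum: "(p :: 'a \<Rightarrow>\<^sub>0 'b::comm_monoid_add) = (\<Sum>s\<in>keys p. single s (lookup p s))"
  by (rule poly_mapping_eqI) (simp add: lookup_sum lookup_single when_def in_keys_iff)

lemma poly_eval_mult: "poly_eval a (p * q) = poly_eval a p * poly_eval a q"
proof -
  have "p * q = (\<Sum>s\<in>keys p. \<Sum>t\<in>keys q. single (s + t) (lookup p s * lookup q t))"
    by (subst (1) poly_as_sum[of p], subst (1) poly_as_sum[of q])
       (simp add: sum_product mult_single)
  then have "poly_eval a (p * q) = (\<Sum>s\<in>keys p. \<Sum>t\<in>keys q.
      (lookup p s * monom_eval a s) * (lookup q t * monom_eval a t))"
    by (simp add: poly_eval_sum monom_eval_add algebra_simps)
  also have "\<dots> = poly_eval a p * poly_eval a q"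
    by (simp add: poly_eval_superset[of "keys p"] poly_eval_superset[of "keys q"] sum_product)
  finally show ?thesis .
qed

lemma poly_eval_one [simp]: "poly_eval a 1 = 1"
  by (simp flip: single_one)

lemma poly_eval_prod: "poly_eval a (\<Prod>x\<in>A. g x) = (\<Prod>x\<in>A. poly_eval a (g x))"
  by (induction A rule: infinite_finite_induct) (auto simp: poly_eval_mult)

lemma poly_eval_power: "poly_eval a (p ^ k) = poly_eval a p ^ k"
  by (induction k) (auto simp: poly_eval_mult)

lemma poly_eval_var [simp]: "poly_eval a (var i) = a i"
  by (simp add: var_def monom_eval_def)

lemma mem_polys: "p \<in> polys n \<longleftrightarrow> (\<forall>s\<in>keys p. keys s \<subseteq> {1..n})"
  by (simp add: poly_ring_def)

lemma poly_ring_simps [simp]: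
  "monoid.mult (poly_ring n) = (*)" "one (poly_ring n) = 1" "zero (poly_ring n) = 0" "add (poly_ring n) = (+)"
  by (auto simp: poly_ring_def)

lemma polys_zero [simp]: "0 \<in> polys n" and polys_one [simp]: "1 \<in> polys n"
  by (auto simp: mem_polys)

lemma polys_single: "keys s \<subseteq> {1..n} \<Longrightarrow> single s c \<in> polys n"
  by (auto simp: mem_polys)

lemma polys_const [simp]: "single 0 c \<in> polys n"
  by (rule polys_single) simp

lemma polys_var: "i \<in> {1..n} \<Longrightarrow> var i \<in> polys n"
  by (auto simp: mem_polys var_def)

lemma polys_add: "p \<in> polys n \<Longrightarrow> q \<in> polys n \<Longrightarrow> p + q \<in> polys n"
  using cring.cring_simprules(1)[OF cring_poly_ring] by simp

lemma polys_mult: "p \<in> polys n \<Longrightarrow> q \<in> polys n \<Longrightarrow> p * q \<in> polys n"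
  using cring.cring_simprules(5)[OF cring_poly_ring] by simp

lemma polys_uminus: "p \<in> polys n \<Longrightarrow> - p \<in> polys n"
  by (auto simp: mem_polys)

lemma polys_diff: "p \<in> polys n \<Longrightarrow> q \<in> polys n \<Longrightarrow> p - q \<in> polys n"
  using polys_add[of p n "- q"] polys_uminus[of q n] by simp

lemma polys_prod: "(\<And>x. x \<in> A \<Longrightarrow> g x \<in> polys n) \<Longrightarrow> (\<Prod>x\<in>A. g x) \<in> polys n"
  by (induction A rule: infinite_finite_induct) (auto intro: polys_mult)

lemma nat_pow_poly_ring: "p [^]\<^bsub>poly_ring n\<^esub> (k::nat) = p ^ k"
  by (induction k) (auto simp: nat_pow_def mult.commute)

lemma monomial_induct:
  fixes P :: "'k::field mpoly \<Rightarrow> bool"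
  assumes one: "P 1" and var: "\<And>i. i \<in> {1..n} \<Longrightarrow> P (var i)"
    and mult: "\<And>p q. P p \<Longrightarrow> P q \<Longrightarrow> P (p * q)"
    and s: "keys s \<subseteq> {1..n}"
  shows "P (single s 1)"
  using s
proof (induction s rule: update_induct)
  case const
  then show ?case using one by simp
next
  case (update s i e)
  have eq: "Poly_Mapping.update i e s = s + single i e"
    using update(1) by (intro poly_mapping_eqI)
      (auto simp: lookup_update lookup_add lookup_single when_def in_keys_iff)
  have k: "keys (Poly_Mapping.update i e s) = insert i (keys s)"
    using update(1,2) by (auto simp: keys_update)
  have "P (single (single i e) 1)"
  proof (induction e)
    case 0
    then show ?case using one by simp
  next
    case (Suc e)
    have "single (single i (Suc e)) 1 = (var i * single (single i e) 1 :: 'k mpoly)"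
      by (simp add: var_def mult_single flip: single_add)
    moreover have "i \<in> {1..n}" using k update.prems by blast
    ultimately show ?case using Suc var mult by metis
  qed
  moreover have "P (single s 1)" using update k by auto
  ultimately have "P (single s 1 * single (single i e) 1)" using mult by blast
  then show ?case by (simp add: eq mult_single)
qed

lemma polys_induct [consumes 1, case_names const var add mult]:
  fixes p :: "'k::field mpoly"
  assumes p: "p \<in> polys n"
    and const: "\<And>c. P (single 0 c)" and var: "\<And>i. i \<in> {1..n} \<Longrightarrow> P (var i)"
    and add: "\<And>p q. P p \<Longrightarrow> P q \<Longrightarrow> P (p + q)" and mult: "\<And>p q. P p \<Longrightarrow> P q \<Longrightarrow> P (p * q)"
  shows "P p"
proof -
  have mon: "P (single s c)" if "s \<in> keys p" for s c
  proof -
    have "P (single s 1)"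
    proof (rule monomial_induct[of P n])
      show "P 1" using const[of 1] by simp
      show "keys s \<subseteq> {1..n}" using p that by (simp add: mem_polys)
    qed (fact var mult)+
    from mult[OF const[of c] this] show ?thesis by (simp add: mult_single)
  qed
  have "P (\<Sum>s\<in>A. single s (lookup p s))" if "finite A" "A \<subseteq> keys p" for A
    using that
  proof (induction A rule: finite_induct)
    case empty
    show ?case using const[of 0] by simp
  next
    case (insert s A)
    then show ?case using add mon by simp
  qed
  from this[of "keys p"] show ?thesis by (simp flip: poly_as_sum)
qed

section \<open>Leading monomials\<close>

lemma lex_less_irrefl: "\<not> lex_less s s"
  by (auto simp: lex_less_def)

lemma lex_less_trans: "lex_less s t \<Longrightarrow> lex_less t u \<Longrightarrow> lex_less s u"
proof -
  assume "lex_less s t" "lex_less t u"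
  then obtain k j where k: "lookup s k < lookup t k" "\<And>i. i > k \<Longrightarrow> lookup s i = lookup t i"
    and j: "lookup t j < lookup u j" "\<And>i. i > j \<Longrightarrow> lookup t i = lookup u i"
    unfolding lex_less_def by blast
  then show ?thesis
    unfolding lex_less_def
    by (intro exI[of _ "max k j"]) (cases k j rule: linorder_cases; fastforce simp: max_def)
qed

lemma lex_less_linear: "s = t \<or> lex_less s t \<or> lex_less t s"
proof (cases "s = t")
  case False
  let ?D = "{i. lookup s i \<noteq> lookup t i}"
  have fin: "finite ?D"
    by (rule finite_subset[of _ "keys s \<union> keys t"]) (auto simp: in_keys_iff)
  have "?D \<noteq> {}" using False by (auto intro: poly_mapping_eqI)
  then have M: "Max ?D \<in> ?D" using fin by (intro Max_in)
  have "lookup s i = lookup t i" if "i > Max ?D" for i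
    using Max_ge[OF fin, of i] that by force
  with M show ?thesis unfolding lex_less_def by (metis (mono_tags, lifting) mem_Collect_eq linorder_neqE_nat)
qed simp

lemma lex_less_add_right: "lex_less s t \<Longrightarrow> lex_less (s + u) (t + u)"
  unfolding lex_less_def by (auto simp: lookup_add)

lemma lex_less_add_left: "lex_less s t \<Longrightarrow> lex_less (u + s) (u + t)"
  unfolding lex_less_def by (auto simp: lookup_add)

text \<open>With finitely many variables the lexicographic order compares exponent lists of a fixed
  length, largest variable first; this makes the division algorithm terminate.\<close>
lemma wf_lex_less: "wf {(s, t). keys s \<subseteq> {1..n} \<and> keys t \<subseteq> {1..n} \<and> lex_less s t}"
proof (rule wf_subset)
  let ?v = "\<lambda>s. map (lookup s) (rev [1..<Suc n])"
  show "wf (inv_image (lenlex less_than) ?v)"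
    by (intro wf_inv_image wf_lenlex) simp
  show "{(s, t). keys s \<subseteq> {1..n} \<and> keys t \<subseteq> {1..n} \<and> lex_less s t}
      \<subseteq> inv_image (lenlex less_than) ?v"
  proof safe
    fix s t :: "nat \<Rightarrow>\<^sub>0 nat"
    assume st: "keys s \<subseteq> {1..n}" "keys t \<subseteq> {1..n}" "lex_less s t"
    then obtain k where k: "lookup s k < lookup t k" "\<And>i. i > k \<Longrightarrow> lookup s i = lookup t i"
      unfolding lex_less_def by blast
    have kn: "1 \<le> k" "k \<le> n" using k(1) st(2) by (auto simp: in_keys_iff subset_eq)
    have "[1..<Suc n] = [1..<k] @ k # [Suc k..<Suc n]"
      using kn upt_add_eq_append[of 1 k "Suc n - k"] upt_conv_Cons[of k "Suc n"] by (simp del: upt_Suc)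
    then have sp: "rev [1..<Suc n] = rev [Suc k..<Suc n] @ k # rev [1..<k]"
      by simp
    have "(?v s, ?v t) \<in> lex less_than"
      unfolding lex_conv sp using k
      by (intro CollectI case_prodI conjI exI[of _ "map (lookup s) (rev [Suc k..<Suc n])"]
          exI[of _ "lookup s k"] exI[of _ "lookup t k"] exI[of _ "map (lookup s) (rev [1..<k])"]
          exI[of _ "map (lookup t) (rev [1..<k])"]) auto
    then show "(s, t) \<in> inv_image (lenlex less_than) ?v"
      by (simp add: lenlex_conv)
  qed
qed

definition is_leading :: "'k::field mpoly \<Rightarrow> (nat \<Rightarrow>\<^sub>0 nat) \<Rightarrow> bool" where
  "is_leading p s \<longleftrightarrow> s \<in> keys p \<and> (\<forall>t\<in>keys p. t \<noteq> s \<longrightarrow> lex_less t s)"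

lemma leading_monomialI: "is_leading p s \<Longrightarrow> leading_monomial p = s"
  unfolding leading_monomial_def is_leading_def
proof (rule the_equality)
  fix t
  assume "s \<in> keys p \<and> (\<forall>t\<in>keys p. t \<noteq> s \<longrightarrow> lex_less t s)"
    "t \<in> keys p \<and> (\<forall>u\<in>keys p. u \<noteq> t \<longrightarrow> lex_less u t)"
  then show "t = s" using lex_less_trans[of s t s] lex_less_irrefl[of s] by metis
qed

lemma is_leading_leading_monomial:
  assumes "p \<noteq> 0"
  shows "is_leading p (leading_monomial p)"
proof -
  have "\<exists>s\<in>A. \<forall>t\<in>A. t \<noteq> s \<longrightarrow> lex_less t s" if "finite A" "A \<noteq> {}" for A
    using that
  proof (induction A rule: finite_ne_induct)
    case (insert x A)
    then obtain s where s: "s \<in> A" "\<forall>t\<in>A. t \<noteq> s \<longrightarrow> lex_less t s" by blast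
    show ?case
    proof (cases "lex_less s x")
      case True
      then have "lex_less t x" if "t \<in> A" for t
        using s(2) that lex_less_trans by metis
      then show ?thesis by blast
    next
      case False
      then show ?thesis
        using s lex_less_linear[of x s] by blast
    qed
  qed auto
  moreover have "keys p \<noteq> {}" using assms by (simp add: keys_eq_empty)
  ultimately have "\<exists>s\<in>keys p. \<forall>t\<in>keys p. t \<noteq> s \<longrightarrow> lex_less t s" by simp
  then obtain s where "is_leading p s" unfolding is_leading_def by blast
  then show ?thesis using leading_monomialI[of p s] by simp
qed

lemma leading_monomial_in_keys: "p \<noteq> 0 \<Longrightarrow> leading_monomial p \<in> keys p"
  using is_leading_leading_monomial[of p] by (simp add: is_leading_def)

lemma is_leading_tail:
  assumes "is_leading p s"
  obtains p' where "p = single s (lookup p s) + p'" "\<forall>t\<in>keys p'. t \<in> keys p \<and> lex_less t s"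
proof (rule that)
  define p' where "p' = p - single s (lookup p s)"
  have lk: "lookup p' t = (if t = s then 0 else lookup p t)" for t
    unfolding p'_def by (simp add: lookup_minus lookup_single)
  show "p = single s (lookup p s) + (p - single s (lookup p s))" by (simp only: add_diff_eq add_diff_cancel_left')
  have "t \<in> keys p \<and> lex_less t s" if "t \<in> keys p'" for t
  proof -
    have "t \<noteq> s" "t \<in> keys p" using that by (auto simp: in_keys_iff lk split: if_splits)
    then show ?thesis using assms by (simp add: is_leading_def)
  qed
  then show "\<forall>t\<in>keys (p - single s (lookup p s)). t \<in> keys p \<and> lex_less t s"
    by (simp add: p'_def)
qed

text \<open>The order is compatible with addition of exponents, so in a product of two polynomials
  the product of the leading terms exceeds every other term and cannot cancel.\<close>
lemma is_leading_mult:
  assumes p: "is_leading p s" and q: "is_leading q t"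
  shows "is_leading (p * q) (s + t)"
proof -
  obtain p' where p': "p = single s (lookup p s) + p'" "\<forall>t\<in>keys p'. t \<in> keys p \<and> lex_less t s"
    using is_leading_tail[OF p] .
  obtain q' where q': "q = single t (lookup q t) + q'" "\<forall>u\<in>keys q'. u \<in> keys q \<and> lex_less u t"
    using is_leading_tail[OF q] .
  let ?c = "lookup p s * lookup q t"
  define r where "r = single s (lookup p s) * q' + p' * q"
  have c: "?c \<noteq> 0" using p q by (auto simp: is_leading_def in_keys_iff)
  have pq: "p * q = single (s + t) ?c + r"
    unfolding r_def
  proof -
    have "p * q = single s (lookup p s) * q + p' * q"
      by (subst p'(1)) (simp only: distrib_right)
    also have "single s (lookup p s) * q = single (s + t) ?c + single s (lookup p s) * q'"
      by (subst q'(1)) (simp only: distrib_left mult_single)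
    finally show "p * q = single (s + t) ?c + (single s (lookup p s) * q' + p' * q)"
      by (simp only: add.assoc)
  qed
  have r: "lex_less u (s + t)" if "u \<in> keys r" for u
  proof -
    have "u \<in> keys (single s (lookup p s) * q') \<or> u \<in> keys (p' * q)"
      using that keys_add[of "single s (lookup p s) * q'" "p' * q"] unfolding r_def by blast
    then show ?thesis
    proof
      assume "u \<in> keys (single s (lookup p s) * q')"
      then obtain w v where "w \<in> keys (single s (lookup p s))" "v \<in> keys q'" "u = w + v"
        using keys_mult[of "single s (lookup p s)" q'] by blast
      then show ?thesis using q'(2) lex_less_add_left[of v t s] by (simp split: if_splits)
    next
      assume "u \<in> keys (p' * q)"
      then obtain v w where vw: "v \<in> keys p'" "w \<in> keys q" "u = v + w"
        using keys_mult[of p' q] by blast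
      have "lex_less (v + w) (s + w)" using vw p'(2) lex_less_add_right by simp
      moreover have "w = t \<or> lex_less (s + w) (s + t)"
        using vw(2) q lex_less_add_left[of w t s] unfolding is_leading_def by blast
      ultimately show ?thesis using vw(3) lex_less_trans[of "v + w" "s + w" "s + t"] by auto
    qed
  qed
  have "s + t \<notin> keys r" using r lex_less_irrefl[of "s + t"] by blast
  then have "s + t \<in> keys (p * q)"
    using c unfolding pq by (simp add: in_keys_iff lookup_add)
  moreover have "lex_less u (s + t)" if "u \<in> keys (p * q)" "u \<noteq> s + t" for u
  proof -
    have "u \<in> keys (single (s + t) ?c) \<union> keys r"
      using that(1) keys_add[of "single (s + t) ?c" r] unfolding pq by blast
    then have "u \<in> keys r" using that(2) by (simp split: if_splits)
    then show ?thesis by (rule r)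
  qed
  ultimately show ?thesis by (auto simp: is_leading_def)
qed

lemma leading_monomial_mult:
  assumes "p \<noteq> 0" "q \<noteq> 0"
  shows "leading_monomial (p * q) = leading_monomial p + leading_monomial q"
  using assms by (intro leading_monomialI is_leading_mult is_leading_leading_monomial)

lemma leading_monomial_prod:
  assumes "finite A" "\<And>x. x \<in> A \<Longrightarrow> g x \<noteq> 0"
  shows "leading_monomial (\<Prod>x\<in>A. g x) = (\<Sum>x\<in>A. leading_monomial (g x))"
  using assms
proof (induction A rule: finite_induct)
  case empty
  show ?case by (simp, rule leading_monomialI) (simp add: is_leading_def)
next
  case (insert x A)
  then have "(\<Prod>x\<in>A. g x) \<noteq> 0" by (auto simp: prod_zero_iff)
  with insert show ?case by (simp add: leading_monomial_mult)
qed

lemma leading_monomial_var_diff: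
  assumes "a < b"
  shows "leading_monomial (var a - var b :: 'k::field mpoly) = single b 1"
proof (rule leading_monomialI)
  have ne: "single a (1::nat) \<noteq> single b 1"
    using assms by (metis lookup_single_eq lookup_single_not_eq less_irrefl zero_neq_one)
  have "keys (var a - var b :: 'k mpoly) = {single a 1, single b 1}"
    using ne by (auto simp: var_def in_keys_iff lookup_minus lookup_single when_def split: if_splits)
  moreover have "lex_less (single a 1) (single b 1)"
    using assms unfolding lex_less_def by (intro exI[of _ b]) (auto simp: lookup_single when_def)
  ultimately show "is_leading (var a - var b :: 'k mpoly) (single b 1)"
    by (auto simp: is_leading_def)
qed

section \<open>Vanishing on points and divisibility\<close>

lemma lex_less_add_cancel: "lex_less (s + u) (t + u) \<Longrightarrow> lex_less s t"
  unfolding lex_less_def by (auto simp: lookup_add)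

text \<open>The polynomial \<open>g\<close> is the coefficient of the highest power \<open>d\<close> of the last variable.
  The last variable is the largest one, so \<open>g\<close> carries the rest of the leading monomial. The
  last conclusion is the root bound: if fixing the other coordinates leaves a univariate
  polynomial of degree at most \<open>d\<close> with more than \<open>d\<close> roots, its top coefficient is zero.\<close>
lemma leading_coefficient:
  fixes f :: "'k::field mpoly"
  assumes f: "f \<in> polys (Suc n)" and "f \<noteq> 0"
  obtains g d where "g \<in> polys n" "g \<noteq> 0" "leading_monomial f = leading_monomial g + single (Suc n) d"
    "\<And>a V. finite V \<Longrightarrow> d < card V \<Longrightarrow> \<forall>v\<in>V. poly_eval (a(Suc n := v)) f = 0 \<Longrightarrow> poly_eval a g = 0"
proof -
  define N where "N = Suc n"
  define L where "L = leading_monomial f"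
  define d where "d = lookup L N"
  define e where "e = single N d"
  \<comment> \<open>As \<open>d\<close> is the largest exponent of the last variable, no term of \<open>g\<close> involves it.\<close>
  define g where "g = Poly_Mapping.map_key (\<lambda>t. t + e) f"
  have L: "is_leading f L" using \<open>f \<noteq> 0\<close> by (simp add: L_def is_leading_leading_monomial)
  have kf: "keys s \<subseteq> {1..N}" if "s \<in> keys f" for s
    using f that by (simp add: mem_polys N_def)
  have deg: "lookup s N \<le> d" if s: "s \<in> keys f" for s
  proof (cases "s = L")
    case False
    then obtain k where k: "lookup s k < lookup L k" "\<forall>i>k. lookup s i = lookup L i"
      using L s unfolding is_leading_def lex_less_def by blast
    have "keys L \<subseteq> {1..N}" using kf L by (simp add: is_leading_def)
    then have "k \<le> N" using k(1) by (auto simp: in_keys_iff subset_eq)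
    then show ?thesis using k by (cases "k = N") (auto simp: d_def)
  qed (simp add: d_def)
  have inj: "inj (\<lambda>t::nat \<Rightarrow>\<^sub>0 nat. t + e)" by (rule injI) simp
  have lg: "lookup g t = lookup f (t + e)" for t
    unfolding g_def by (simp add: map_key.rep_eq[OF inj])
  have kg: "t \<in> keys g \<longleftrightarrow> t + e \<in> keys f" for t by (simp add: in_keys_iff lg)
  have tN: "lookup t N = 0" if "t \<in> keys g" for t
    using deg[of "t + e"] that by (simp add: kg lookup_add e_def)
  have g: "g \<in> polys n"
  proof -
    have "keys t \<subseteq> {1..n}" if t: "t \<in> keys g" for t
    proof
      fix i assume i: "i \<in> keys t"
      then have "i \<in> keys (t + e)" by (simp add: in_keys_iff lookup_add)
      then have "i \<in> {1..N}" using kf t kg by blast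
      moreover have "i \<noteq> N" using i tN[OF t] by (auto simp: in_keys_iff)
      ultimately show "i \<in> {1..n}" by (simp add: N_def)
    qed
    then show ?thesis by (simp add: mem_polys)
  qed
  define L' where "L' = L - e"
  have L': "L = L' + e"
    by (rule poly_mapping_eqI) (simp add: L'_def e_def lookup_add lookup_minus lookup_single d_def when_def)
  have lead: "is_leading g L'"
    unfolding is_leading_def
  proof (intro conjI ballI impI)
    show "L' \<in> keys g" using L by (simp add: kg is_leading_def flip: L')
    fix t assume "t \<in> keys g" "t \<noteq> L'"
    then have "lex_less (t + e) (L' + e)" using L by (simp add: kg is_leading_def L')
    then show "lex_less t L'" by (rule lex_less_add_cancel)
  qed
  define r where "r s = s - single N (lookup s N)" for s :: "nat \<Rightarrow>\<^sub>0 nat"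
  have r: "s = r s + single N (lookup s N)" for s
    by (rule poly_mapping_eqI) (simp add: r_def lookup_add lookup_minus lookup_single when_def)
  have rN: "N \<notin> keys (r s)" for s by (simp add: r_def in_keys_iff lookup_minus)
  \<comment> \<open>The restriction of \<open>f\<close> to a line parallel to the last coordinate axis.\<close>
  define P where "P a = (\<Sum>s\<in>keys f. monom (lookup f s * monom_eval a (r s)) (lookup s N))" for a
  have ev: "poly (P a) v = poly_eval (a(N := v)) f" for a v
  proof -
    have "monom_eval (a(N := v)) (r s) = monom_eval a (r s)" for s
      unfolding monom_eval_def by (intro prod.cong) (use rN in auto)
    moreover have "monom_eval (a(N := v)) (single N k) = v ^ k" for k
      by (simp add: monom_eval_def)
    ultimately have "monom_eval (a(N := v)) s = monom_eval a (r s) * v ^ lookup s N" for s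
      by (subst r) (simp only: monom_eval_add)
    then show ?thesis
      by (simp add: P_def poly_sum poly_monom poly_eval_superset[of "keys f"] mult.assoc)
  qed
  have dP: "degree (P a) \<le> d" for a
    unfolding P_def using deg by (intro degree_sum_le) (auto intro: le_trans[OF degree_monom_le])
  have cP: "coeff (P a) d = poly_eval a g" for a
  proof -
    have "coeff (P a) d = (\<Sum>s\<in>{s\<in>keys f. lookup s N = d}. lookup f s * monom_eval a (r s))"
      unfolding P_def coeff_sum coeff_monom by (rule sum.inter_filter[symmetric]) simp
    also have "\<dots> = (\<Sum>t\<in>keys g. lookup g t * monom_eval a t)"
    proof (rule sum.reindex_bij_witness[of _ "\<lambda>t. t + e" r])
      fix s assume "s \<in> {s \<in> keys f. lookup s N = d}"
      then have s: "s \<in> keys f" "r s + e = s" using r[of s] by (simp_all add: e_def)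
      then show "r s + e = s" "r s \<in> keys g" 
        "lookup g (r s) * monom_eval a (r s) = lookup f s * monom_eval a (r s)"
        by (simp_all add: kg lg)
    next
      fix t assume t: "t \<in> keys g"
      show "t + e \<in> {s \<in> keys f. lookup s N = d}" 
        using t tN[OF t] by (simp add: kg lookup_add e_def)
      show "r (t + e) = t"
        using tN[OF t] by (intro poly_mapping_eqI)
          (simp add: r_def lookup_add lookup_minus lookup_single e_def when_def)
    qed
    finally show ?thesis by (simp add: poly_eval_superset[of "keys g"])
  qed
  show ?thesis
  proof (rule that[OF g])
    show "g \<noteq> 0" using lead by (auto simp: is_leading_def)
    show "leading_monomial f = leading_monomial g + single (Suc n) d"
      using leading_monomialI[OF lead] L' by (simp add: L_def e_def N_def)
    fix a V
    assume V: "finite V" "d < card V" "\<forall>v\<in>V. poly_eval (a(Suc n := v)) f = 0"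
    have "P a = 0"
    proof (rule ccontr)
      assume P: "P a \<noteq> 0"
      have "V \<subseteq> {v. poly (P a) v = 0}" using V(3) by (auto simp: ev N_def)
      then have "card V \<le> card {v. poly (P a) v = 0}"
        by (intro card_mono poly_roots_finite P)
      also have "\<dots> \<le> degree (P a)" by (rule card_poly_roots_bound[OF P])
      finally show False using V(2) dP[of a] by simp
    qed
    then show "poly_eval a g = 0" by (simp flip: cP)
  qed
qed

text \<open>Over an infinite field polynomials are determined by their values: peel off one variable
  at a time by passing to the leading coefficient.\<close>
lemma vanishing_imp_zero:
  fixes p :: "'k::field mpoly"
  assumes inf: "infinite (UNIV :: 'k set)" and "p \<in> polys n" "\<And>a. poly_eval a p = 0"
  shows "p = 0"
  using assms(2,3)
proof (induction n arbitrary: p)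
  case 0
  have "keys p \<subseteq> {0}" using 0(1) by (auto simp: mem_polys keys_eq_empty)
  then have "poly_eval (\<lambda>_. 0) p = lookup p 0" by (subst poly_eval_superset[of "{0}"]) auto
  then have "0 \<notin> keys p" using 0(2) by (simp add: in_keys_iff)
  with \<open>keys p \<subseteq> {0}\<close> have "keys p = {}" by blast
  then show ?case by (simp add: keys_eq_empty)
next
  case (Suc n)
  show ?case
  proof (rule ccontr)
    assume "p \<noteq> 0"
    then obtain g d where g: "g \<in> polys n" "g \<noteq> 0"
      "\<And>a V. finite V \<Longrightarrow> d < card V \<Longrightarrow> \<forall>v\<in>V. poly_eval (a(Suc n := v)) p = 0 \<Longrightarrow> poly_eval a g = 0"
      using leading_coefficient[OF Suc(2)] by metis
    obtain V :: "'k set" where "finite V" "card V = Suc d"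
      using infinite_arbitrarily_large[OF inf] by blast
    then have "poly_eval a g = 0" for a using g(3)[of V a] Suc(3) by simp
    then show False using Suc(1)[OF g(1)] g(2) by blast
  qed
qed

text \<open>Modulo \<open>x\<^sub>a - x\<^sub>b\<close>, a polynomial is congruent to the result of substituting \<open>x\<^sub>a\<close>
  for \<open>x\<^sub>b\<close>; the substitution is only described through its values.\<close>
lemma remainder_var_diff:
  fixes p :: "'k::field mpoly"
  assumes "p \<in> polys n" and a: "a \<in> {1..n}" and b: "b \<in> {1..n}"
  shows "\<exists>q\<in>polys n. \<exists>r\<in>polys n. p = (var a - var b) * q + r \<and>
           (\<forall>\<alpha>. poly_eval \<alpha> r = poly_eval (\<alpha>(b := \<alpha> a)) p)"
  using assms(1)
proof (induction p rule: polys_induct)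
  case (const c)
  show ?case by (intro bexI[of _ 0] bexI[of _ "single 0 c"]) auto
next
  case (var i)
  show ?case
  proof (cases "i = b")
    case True
    then show ?thesis using a
      by (intro bexI[of _ "- 1"] bexI[of _ "var a"]) (auto simp: polys_var polys_uminus)
  next
    case False
    then show ?thesis using var
      by (intro bexI[of _ 0] bexI[of _ "var i"]) (auto simp: polys_var)
  qed
next
  case (add p q)
  then obtain p1 p2 q1 q2 where *: "p1 \<in> polys n" "p2 \<in> polys n" "p = (var a - var b) * p1 + p2"
    "\<forall>\<alpha>. poly_eval \<alpha> p2 = poly_eval (\<alpha>(b := \<alpha> a)) p"
    "q1 \<in> polys n" "q2 \<in> polys n" "q = (var a - var b) * q1 + q2"
    "\<forall>\<alpha>. poly_eval \<alpha> q2 = poly_eval (\<alpha>(b := \<alpha> a)) q" by blast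
  let ?D = "var a - var b :: 'k mpoly"
  show ?case
  proof (rule rev_bexI[OF polys_add[OF *(1,5)]], rule rev_bexI[OF polys_add[OF *(2,6)]],
      intro conjI allI)
    show "p + q = ?D * (p1 + q1) + (p2 + q2)"
      unfolding *(3,7) by (simp add: algebra_simps)
    show "poly_eval \<alpha> (p2 + q2) = poly_eval (\<alpha>(b := \<alpha> a)) (p + q)" for \<alpha>
      using *(4,8) by (simp only: poly_eval_add)
  qed
next
  case (mult p q)
  then obtain p1 p2 q1 q2 where *: "p1 \<in> polys n" "p2 \<in> polys n" "p = (var a - var b) * p1 + p2"
    "\<forall>\<alpha>. poly_eval \<alpha> p2 = poly_eval (\<alpha>(b := \<alpha> a)) p"
    "q1 \<in> polys n" "q2 \<in> polys n" "q = (var a - var b) * q1 + q2"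
    "\<forall>\<alpha>. poly_eval \<alpha> q2 = poly_eval (\<alpha>(b := \<alpha> a)) q" by blast
  let ?D = "var a - var b :: 'k mpoly"
  let ?q = "p1 * (?D * q1 + q2) + p2 * q1"
  have q: "?q \<in> polys n" "p2 * q2 \<in> polys n"
    using * a b by (auto intro!: polys_add polys_mult polys_diff polys_var)
  show ?case
  proof (rule rev_bexI[OF q(1)], rule rev_bexI[OF q(2)], intro conjI allI)
    show "p * q = ?D * ?q + p2 * q2"
      unfolding *(3,7) by (simp add: algebra_simps)
    show "poly_eval \<alpha> (p2 * q2) = poly_eval (\<alpha>(b := \<alpha> a)) (p * q)" for \<alpha>
      using *(4,8) by (simp only: poly_eval_mult)
  qed
qed

lemma single_1_inject: "single a (Suc 0) = single b (Suc 0) \<longleftrightarrow> a = b"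
  by (metis lookup_single_eq lookup_single_not_eq nat.distinct(1))

definition diff_prod :: "(nat \<times> nat) set \<Rightarrow> 'k::field mpoly" where
  "diff_prod A = (\<Prod>(a, b)\<in>A. var a - var b)"

definition upper_pairs :: "nat \<Rightarrow> (nat \<times> nat) set" where
  "upper_pairs n = {(a, b). 1 \<le> a \<and> a < b \<and> b \<le> n}"

lemma finite_upper_pairs [simp]: "finite (upper_pairs n)"
  by (rule finite_subset[of _ "{1..n} \<times> {1..n}"]) (auto simp: upper_pairs_def)

lemma poly_eval_diff_prod: "poly_eval \<alpha> (diff_prod A) = (\<Prod>(a, b)\<in>A. \<alpha> a - \<alpha> b)"
  unfolding diff_prod_def by (simp add: poly_eval_prod case_prod_beta poly_eval_diff)

lemma poly_eval_diff_prod_eq_0: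
  "finite A \<Longrightarrow> poly_eval \<alpha> (diff_prod A) = 0 \<longleftrightarrow> (\<exists>(a, b)\<in>A. \<alpha> a = \<alpha> b)"
  by (force simp: poly_eval_diff_prod prod_zero_iff)

lemma polys_diff_prod: "A \<subseteq> upper_pairs n \<Longrightarrow> diff_prod A \<in> polys n"
  unfolding diff_prod_def by (rule polys_prod) (auto simp: upper_pairs_def intro!: polys_diff polys_var)

lemma diff_prod_nonzero:
  assumes "A \<subseteq> upper_pairs n"
  shows "diff_prod A \<noteq> (0 :: 'k::field mpoly)"
proof -
  have "var a - var b \<noteq> (0 :: 'k mpoly)" if ab: "(a, b) \<in> A" for a b
  proof
    assume "var a - var b = (0 :: 'k mpoly)"
    then have "lookup (var a :: 'k mpoly) (single b 1) = lookup (var b :: 'k mpoly) (single b 1)" by simp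
    then have "a = b" by (simp add: var_def lookup_single when_def single_1_inject split: if_splits)
    then show False using ab assms by (auto simp: upper_pairs_def)
  qed
  moreover have "finite A" using assms by (rule finite_subset) simp
  ultimately show ?thesis by (simp add: diff_prod_def prod_zero_iff case_prod_beta)
qed

lemma leading_monomial_diff_prod:
  assumes "A \<subseteq> upper_pairs n"
  shows "leading_monomial (diff_prod A :: 'k::field mpoly) = (\<Sum>(a, b)\<in>A. single b 1)"
proof -
  have fin: "finite A" using assms by (rule finite_subset) simp
  have nz: "(case x of (a, b) \<Rightarrow> var a - var b) \<noteq> (0 :: 'k mpoly)" if "x \<in> A" for x
    using diff_prod_nonzero[of "{x}" n, where 'k='k] that assms by (auto simp: diff_prod_def)
  have lm: "leading_monomial ((case x of (a, b) \<Rightarrow> var a - var b) :: 'k mpoly) = (case x of (a, b) \<Rightarrow> single b 1)"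
    if "x \<in> A" for x
    using that assms leading_monomial_var_diff[of "fst x" "snd x", where 'k='k]
    by (cases x) (auto simp: upper_pairs_def)
  show ?thesis
    unfolding diff_prod_def
    by (rule trans[OF leading_monomial_prod[OF fin nz] sum.cong[OF refl lm]])
qed

text \<open>Each \<open>x\<^sub>a - x\<^sub>b\<close> behaves like a prime element: the substitution of \<open>x\<^sub>a\<close> for \<open>x\<^sub>b\<close> is
  multiplicative and kills exactly the multiples of \<open>x\<^sub>a - x\<^sub>b\<close>, and it does not kill any of the
  other linear forms. So the factors can be split off one after the other.\<close>
lemma diff_prod_divides:
  fixes p :: "'k::field mpoly"
  assumes inf: "infinite (UNIV :: 'k set)" and "A \<subseteq> upper_pairs n" and p: "p \<in> polys n"
    and van: "\<And>\<alpha> a b. (a, b) \<in> A \<Longrightarrow> \<alpha> a = \<alpha> b \<Longrightarrow> poly_eval \<alpha> p = 0"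
  shows "\<exists>q\<in>polys n. p = diff_prod A * q"
proof -
  have "finite A" using assms(2) by (rule finite_subset) simp
  then show ?thesis using assms(2) van
  proof (induction A rule: finite_induct)
    case empty
    then show ?case using p by (simp add: diff_prod_def)
  next
    case (insert x A)
    obtain a b where x: "x = (a, b)" by (cases x)
    have ab: "a \<in> {1..n}" "b \<in> {1..n}" "a < b" using insert.prems(1) by (auto simp: x upper_pairs_def)
    have A: "A \<subseteq> upper_pairs n" using insert.prems(1) by simp
    obtain q where q: "q \<in> polys n" "p = diff_prod A * q"
      using insert.IH[OF A] insert.prems(2) by blast
    obtain r1 q1 where r1: "r1 \<in> polys n" "(diff_prod A :: 'k mpoly) = (var a - var b) * q1 + r1"
      "\<forall>\<alpha>. poly_eval \<alpha> r1 = poly_eval (\<alpha>(b := \<alpha> a)) (diff_prod A)"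
      using remainder_var_diff[OF polys_diff_prod[OF A] ab(1,2)] by blast
    obtain r2 q2 where r2: "r2 \<in> polys n" "q2 \<in> polys n" "q = (var a - var b) * q2 + r2"
      "\<forall>\<alpha>. poly_eval \<alpha> r2 = poly_eval (\<alpha>(b := \<alpha> a)) q"
      using remainder_var_diff[OF q(1) ab(1,2)] by blast
    have "r1 * r2 = 0"
    proof (rule vanishing_imp_zero[OF inf])
      show "r1 * r2 \<in> polys n" using r1 r2 polys_mult by blast
      fix \<alpha>
      have "poly_eval \<alpha> (r1 * r2) = poly_eval (\<alpha>(b := \<alpha> a)) p"
        using r1(3) r2(4) by (simp add: q(2) poly_eval_mult)
      also have "\<dots> = 0" by (rule insert.prems(2)[of a b]) (use ab in \<open>auto simp: x\<close>)
      finally show "poly_eval \<alpha> (r1 * r2) = 0" .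
    qed
    moreover have "r1 \<noteq> 0"
    proof -
      \<comment> \<open>A point whose only coincidence is between the coordinates \<open>a\<close> and \<open>b\<close>.\<close>
      obtain f :: "nat \<Rightarrow> 'k" where f: "inj f" using inf infinite_countable_subset by blast
      have "(f(b := f a)) c \<noteq> (f(b := f a)) d" if "(c, d) \<in> A" for c d
      proof -
        have "c < d" "(c, d) \<noteq> (a, b)" using that A insert.hyps(2) by (auto simp: upper_pairs_def x)
        then show ?thesis using ab(3) inj_eq[OF f] by auto
      qed
      then have "poly_eval (f(b := f a)) (diff_prod A) \<noteq> 0"
        using poly_eval_diff_prod_eq_0[OF insert.hyps(1), of "f(b := f a)"] by blast
      then show ?thesis using r1(3) by (metis poly_eval_zero)
    qed
    ultimately have "r2 = 0" by simp
    then have "p = diff_prod (insert x A) * q2"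
      using insert.hyps by (simp add: q(2) r2(3) diff_prod_def x mult_ac)
    then show ?case using r2(2) by blast
  qed
qed

section \<open>Partitions\<close>

text \<open>The number of boxes to the right of the first \<open>t\<close> columns. Comparing these numbers for all
  \<open>t\<close> is the majorization form of the dominance order; it does not refer to the order of the
  parts, which makes it easy to track when a box is added.\<close>
definition excess :: "nat list \<Rightarrow> nat \<Rightarrow> nat" where
  "excess \<nu> t = (\<Sum>x\<leftarrow>\<nu>. x - t)"

lemma excess_Cons [simp]: "excess (x # \<nu>) t = (x - t) + excess \<nu> t"
  and excess_Nil [simp]: "excess [] t = 0"
  and excess_append: "excess (\<nu> @ \<mu>) t = excess \<nu> t + excess \<mu> t"
  by (simp_all add: excess_def)

lemma excess_mset: "mset \<nu> = mset \<mu> \<Longrightarrow> excess \<nu> t = excess \<mu> t"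
  unfolding excess_def by (metis mset_map sum_mset_sum_list)

lemma sum_list_le_excess: "sum_list \<nu> \<le> length \<nu> * t + excess \<nu> t"
  by (induction \<nu>) auto

lemma sum_list_eq_excess: "\<forall>x\<in>set \<nu>. t \<le> x \<Longrightarrow> sum_list \<nu> = length \<nu> * t + excess \<nu> t"
  by (induction \<nu>) auto

lemma excess_eq_0: "\<forall>x\<in>set \<nu>. x \<le> t \<Longrightarrow> excess \<nu> t = 0"
  by (induction \<nu>) auto

lemma excess_Suc: "excess \<nu> t = excess \<nu> (Suc t) + length (filter (\<lambda>x. t < x) \<nu>)"
  by (induction \<nu>) auto

text \<open>For \<open>t = \<nu>\<^sub>i\<close> the first \<open>i\<close> parts of \<open>\<nu>\<close> have sum exactly \<open>i t\<close> plus the excess of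
  \<open>\<nu>\<close>, whereas for \<open>\<mu>\<close> the corresponding quantity is an upper bound.\<close>
lemma dominates_if_excess_le:
  assumes \<nu>: "sorted_wrt (\<ge>) \<nu>" and le: "\<And>t. excess \<mu> t \<le> excess \<nu> t"
  shows "dominates \<nu> \<mu>"
  unfolding dominates_def
proof
  fix i assume i: "i \<in> {1..min (length \<nu>) (length \<mu>)}"
  define t where "t = \<nu> ! (i - 1)"
  have srt: "\<nu> ! k \<le> \<nu> ! j" if "j \<le> k" "k < length \<nu>" for j k
    using \<nu> that by (cases "j = k") (auto simp: sorted_wrt_iff_nth_less)
  have 1: "\<forall>x\<in>set (take i \<nu>). t \<le> x"
    using i srt by (auto simp: in_set_conv_nth t_def)
  have 2: "\<forall>x\<in>set (drop i \<nu>). x \<le> t"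
    using i srt by (auto simp: in_set_conv_nth t_def)
  have "sum_list (take i \<mu>) \<le> i * t + excess (take i \<mu>) t"
    using sum_list_le_excess[of "take i \<mu>" t] i by simp
  also have "\<dots> \<le> i * t + excess \<mu> t"
    using excess_append[of "take i \<mu>" "drop i \<mu>" t] by simp
  also have "\<dots> \<le> i * t + excess \<nu> t" using le by simp
  also have "excess \<nu> t = excess (take i \<nu>) t"
    using excess_append[of "take i \<nu>" "drop i \<nu>" t] excess_eq_0[OF 2] by simp
  also have "i * t + excess (take i \<nu>) t = sum_list (take i \<nu>)"
    using sum_list_eq_excess[OF 1] i by simp
  finally show "sum_list (take i \<mu>) \<le> sum_list (take i \<nu>)" .
qed

definition part :: "nat list \<Rightarrow> nat \<Rightarrow> nat" where
  "part \<nu> r = (if r < length \<nu> then \<nu> ! r else 0)"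

text \<open>The first row of the same length as row \<open>d\<close>, where a box can be added without leaving
  the partitions. Rows beyond the last one count as empty, so this is the first empty row for
  large \<open>d\<close>.\<close>
definition corner :: "nat list \<Rightarrow> nat \<Rightarrow> nat" where
  "corner \<nu> d = (LEAST r. part \<nu> r = part \<nu> d)"

definition add_box :: "nat list \<Rightarrow> nat \<Rightarrow> nat list" where
  "add_box \<nu> r = (if r < length \<nu> then \<nu>[r := Suc (\<nu> ! r)] else \<nu> @ [1])"

lemma part_corner: "part \<nu> (corner \<nu> d) = part \<nu> d"
  unfolding corner_def by (rule LeastI) (rule refl)

lemma corner_le: "corner \<nu> d \<le> d"
  unfolding corner_def by (rule Least_le) simp

lemma corner_le_length: "corner \<nu> d \<le> length \<nu>"
proof (cases "d < length \<nu>")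
  case True
  then show ?thesis using corner_le[of \<nu> d] by simp
next
  case False
  then show ?thesis unfolding corner_def by (intro Least_le) (simp add: part_def)
qed

lemma part_antimono: "sorted_wrt (\<ge>) \<nu> \<Longrightarrow> i \<le> j \<Longrightarrow> part \<nu> j \<le> part \<nu> i"
  by (cases "i = j") (auto simp: part_def sorted_wrt_iff_nth_less)

lemma part_less_corner:
  assumes "sorted_wrt (\<ge>) \<nu>" "i < corner \<nu> d"
  shows "part \<nu> (corner \<nu> d) < part \<nu> i"
proof -
  have "part \<nu> i \<noteq> part \<nu> d" using assms(2) not_less_Least unfolding corner_def by blast
  then show ?thesis
    using part_antimono[OF assms(1), of i "corner \<nu> d"] assms(2) by (simp add: part_corner)
qed

lemma nth_add_box:
  assumes "r \<le> length \<nu>" "i < length (add_box \<nu> r)"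
  shows "add_box \<nu> r ! i = (if i = r then Suc (part \<nu> r) else part \<nu> i)"
  using assms by (auto simp: add_box_def part_def nth_append nth_list_update less_Suc_eq split: if_splits)

lemma excess_add_box:
  assumes "r \<le> length \<nu>"
  shows "excess (add_box \<nu> r) t = excess \<nu> t + of_bool (t \<le> part \<nu> r)"
proof (cases "r < length \<nu>")
  case True
  then have "\<nu> = take r \<nu> @ \<nu> ! r # drop (Suc r) \<nu>" by (rule id_take_nth_drop)
  then have "excess \<nu> t = excess (take r \<nu>) t + ((\<nu> ! r - t) + excess (drop (Suc r) \<nu>) t)"
    by (metis excess_append excess_Cons)
  moreover have "excess (add_box \<nu> r) t
      = excess (take r \<nu>) t + ((Suc (\<nu> ! r) - t) + excess (drop (Suc r) \<nu>) t)"
    using True by (simp add: add_box_def upd_conv_take_nth_drop excess_append)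
  ultimately show ?thesis using True by (auto simp: part_def)
qed (auto simp: add_box_def part_def excess_append)

lemma sum_list_excess_0: "sum_list \<nu> = excess \<nu> 0"
  by (simp add: excess_def)

lemma add_box_partitions:
  assumes \<nu>: "\<nu> \<in> partitions N"
  shows "add_box \<nu> (corner \<nu> d) \<in> partitions (Suc N)"
proof -
  let ?r = "corner \<nu> d" and ?\<mu> = "add_box \<nu> (corner \<nu> d)"
  have s: "sorted_wrt (\<ge>) \<nu>" using \<nu> by (simp add: partitions_def)
  have r: "?r \<le> length \<nu>" by (rule corner_le_length)
  have "?\<mu> ! j \<le> ?\<mu> ! i" if "i < j" "j < length ?\<mu>" for i j
  proof -
    have "part \<nu> j \<le> part \<nu> i" using that by (intro part_antimono s) simp
    then show ?thesis
      using that part_less_corner[OF s, of i d] by (auto simp: nth_add_box[OF r])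
  qed
  then have "sorted_wrt (\<ge>) ?\<mu>" by (simp add: sorted_wrt_iff_nth_less)
  moreover have "\<forall>p\<in>set ?\<mu>. 0 < p"
    using \<nu> by (auto simp: partitions_def add_box_def dest: set_update_subset_insert[THEN subsetD])
  moreover have "sum_list ?\<mu> = Suc N"
    using \<nu> by (simp add: partitions_def sum_list_excess_0 excess_add_box[OF r])
  ultimately show ?thesis by (simp add: partitions_def)
qed

lemma partitions_nonempty: "\<nu> \<in> partitions N \<Longrightarrow> 1 \<le> N \<Longrightarrow> \<nu> \<noteq> []"
  by (auto simp: partitions_def)

lemma add_box_partitions_ge:
  assumes \<nu>: "\<nu> \<in> partitions_ge N l" and N: "1 \<le> N"
  shows "add_box \<nu> (corner \<nu> d) \<in> partitions_ge (Suc N) l"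
proof -
  have p: "\<nu> \<in> partitions N" "l \<le> hd \<nu>" using \<nu> by (auto simp: partitions_ge_def)
  have "\<nu> \<noteq> []" using p N partitions_nonempty by blast
  then have "hd \<nu> \<le> hd (add_box \<nu> (corner \<nu> d))"
    by (cases \<nu>; cases "corner \<nu> d") (auto simp: add_box_def)
  then show ?thesis using p add_box_partitions by (auto simp: partitions_ge_def)
qed

lemma length_filter_less_le:
  assumes "sorted_wrt (\<ge>) \<nu>" "part \<nu> d \<le> t"
  shows "length (filter (\<lambda>x. t < x) \<nu>) \<le> d"
proof -
  have "i < d" if i: "i < length \<nu>" "t < \<nu> ! i" for i
  proof (rule ccontr)
    assume "\<not> i < d"
    then have "part \<nu> i \<le> part \<nu> d" by (intro part_antimono assms) simp
    then show False using i assms(2) by (simp add: part_def)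
  qed
  then have "{i. i < length \<nu> \<and> t < \<nu> ! i} \<subseteq> {..<d}" by auto
  from card_mono[OF _ this] show ?thesis by (simp add: length_filter_conv_card)
qed

lemma less_length_filter_le:
  assumes "sorted_wrt (\<ge>) \<nu>" "d < length \<nu>" "t \<le> part \<nu> d"
  shows "d < length (filter (\<lambda>x. t \<le> x) \<nu>)"
proof -
  have "t \<le> \<nu> ! i" if "i \<le> d" for i
    using part_antimono[OF assms(1) that] assms that by (simp add: part_def)
  then have "{..d} \<subseteq> {i. i < length \<nu> \<and> t \<le> \<nu> ! i}" using assms(2) by auto
  from card_mono[OF _ this] show ?thesis by (simp add: length_filter_conv_card)
qed

text \<open>The only danger is an index \<open>t\<close> with \<open>\<nu>\<^sub>d < t \<le> \<mu>\<^sub>d\<close> in which the excesses agree. But then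
  column \<open>t - 1\<close> has at least \<open>d + 1\<close> boxes in \<open>\<mu>\<close> and at most \<open>d\<close> in \<open>\<nu>\<close> (rows and columns
  counted from 0), so that the excess of \<open>\<mu>\<close> would be the larger one at \<open>t - 1\<close>.\<close>
lemma excess_add_box_mono:
  assumes \<nu>: "sorted_wrt (\<ge>) \<nu>" and \<mu>: "sorted_wrt (\<ge>) \<mu>" and le: "\<And>t. excess \<mu> t \<le> excess \<nu> t"
  shows "excess (add_box \<mu> (corner \<mu> d)) t \<le> excess (add_box \<nu> (corner \<nu> d)) t"
proof -
  have "excess \<mu> t + of_bool (t \<le> part \<mu> d) \<le> excess \<nu> t + of_bool (t \<le> part \<nu> d)"
  proof (cases "t \<le> part \<mu> d \<and> \<not> t \<le> part \<nu> d")
    case True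
    then obtain u where u: "t = Suc u" by (cases t) auto
    have "d < length \<mu>" using True u by (auto simp: part_def split: if_splits)
    then have "d < length (filter (\<lambda>x. t \<le> x) \<mu>)" using less_length_filter_le[OF \<mu>] True by blast
    moreover have "length (filter (\<lambda>x. u < x) \<nu>) \<le> d"
      using True u by (intro length_filter_less_le[OF \<nu>]) simp
    ultimately have "excess \<mu> t < excess \<nu> t"
      using le[of u] excess_Suc[of \<mu> u] excess_Suc[of \<nu> u] by (simp add: u Suc_le_eq)
    then show ?thesis using True by simp
  next
    case False
    then show ?thesis using le[of t] by auto
  qed
  then show ?thesis by (simp add: excess_add_box corner_le_length part_corner)
qed

text \<open>A lower filter with respect to the comparison of excesses. This form of the
  notion passes to the leading coefficients without a detour through partial sums of sorted
  lists.\<close>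
definition excess_filter :: "nat \<Rightarrow> nat \<Rightarrow> nat list set \<Rightarrow> bool" where
  "excess_filter N l F \<longleftrightarrow> F \<subseteq> partitions_ge N l \<and>
     (\<forall>\<nu>\<in>F. \<forall>\<mu>\<in>partitions_ge N l. (\<forall>t. excess \<mu> t \<le> excess \<nu> t) \<longrightarrow> \<mu> \<in> F)"

lemma excess_filter_if_lower_filter: "lower_filter N l F \<Longrightarrow> excess_filter N l F"
  unfolding excess_filter_def lower_filter_def
proof (elim conjE, intro conjI ballI impI)
  fix \<nu> \<mu>
  assume F: "F \<subseteq> partitions_ge N l" "\<forall>\<nu>\<in>F. \<forall>\<mu>\<in>partitions_ge N l. dominates \<nu> \<mu> \<longrightarrow> \<mu> \<in> F"
    and \<nu>: "\<nu> \<in> F" and \<mu>: "\<mu> \<in> partitions_ge N l" and le: "\<forall>t. excess \<mu> t \<le> excess \<nu> t"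
  have "sorted_wrt (\<ge>) \<nu>" using F(1) \<nu> by (auto simp: partitions_ge_def partitions_def)
  then have "dominates \<nu> \<mu>" using le by (intro dominates_if_excess_le) auto
  then show "\<mu> \<in> F" using F(2) \<nu> \<mu> by blast
qed

text \<open>The lower filter that controls the coefficient of \<open>x\<^sub>n\<^sup>d\<close>.\<close>
definition lead_filter :: "nat \<Rightarrow> nat \<Rightarrow> nat \<Rightarrow> nat list set \<Rightarrow> nat list set" where
  "lead_filter N l d F = {\<nu> \<in> partitions_ge N l. add_box \<nu> (corner \<nu> d) \<in> F}"

lemma excess_filter_lead_filter:
  assumes F: "excess_filter (Suc N) l F" and N: "1 \<le> N"
  shows "excess_filter N l (lead_filter N l d F)"
  unfolding excess_filter_def
proof (intro conjI ballI impI)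
  fix \<nu> \<mu>
  assume \<nu>: "\<nu> \<in> lead_filter N l d F" and \<mu>: "\<mu> \<in> partitions_ge N l" and le: "\<forall>t. excess \<mu> t \<le> excess \<nu> t"
  have "add_box \<nu> (corner \<nu> d) \<in> F" and srt: "sorted_wrt (\<ge>) \<nu>" "sorted_wrt (\<ge>) \<mu>"
    using \<nu> \<mu> by (auto simp: lead_filter_def partitions_ge_def partitions_def)
  moreover have "add_box \<mu> (corner \<mu> d) \<in> partitions_ge (Suc N) l"
    by (rule add_box_partitions_ge[OF \<mu> N])
  moreover have "\<forall>t. excess (add_box \<mu> (corner \<mu> d)) t \<le> excess (add_box \<nu> (corner \<nu> d)) t"
    using le by (intro allI excess_add_box_mono srt) simp
  ultimately have "add_box \<mu> (corner \<mu> d) \<in> F"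
    using F unfolding excess_filter_def by blast
  then show "\<mu> \<in> lead_filter N l d F" using \<mu> by (simp add: lead_filter_def)
qed (auto simp: lead_filter_def)

section \<open>The partition of a point\<close>

definition word :: "nat \<Rightarrow> nat \<Rightarrow> (nat \<Rightarrow> 'k) \<Rightarrow> 'k list" where
  "word n l a = replicate l (a 1) @ map a [2..<Suc n]"

lemma set_eq_count: "set xs = {v. 0 < count_list xs v}"
  by (metis (no_types, lifting) Collect_cong Collect_mem_eq bot_nat_0.not_eq_extremum count_list_0_iff)

lemma Lambda_word: "Lambda n l a = rev (sort (map (count_list (word n l a)) (remdups (word n l a))))"
  by (simp add: Lambda_def word_def Let_def)

lemma mset_Lambda: "mset (Lambda n l a) = mset (map (count_list (word n l a)) (remdups (word n l a)))"
  by (simp add: Lambda_word)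

lemma set_Lambda: "set (Lambda n l a) = count_list (word n l a) ` set (word n l a)"
  by (simp add: Lambda_word)

lemma excess_Lambda:
  assumes "finite V" "set (word n l a) \<subseteq> V"
  shows "excess (Lambda n l a) t = (\<Sum>v\<in>V. count_list (word n l a) v - t)"
proof -
  have "excess (Lambda n l a) t = (\<Sum>v\<leftarrow>remdups (word n l a). count_list (word n l a) v - t)"
    unfolding excess_mset[OF mset_Lambda] by (simp add: excess_def o_def)
  also have "\<dots> = (\<Sum>v\<in>set (word n l a). count_list (word n l a) v - t)"
    by (subst sum_list_distinct_conv_sum_set) auto
  also have "\<dots> = (\<Sum>v\<in>V. count_list (word n l a) v - t)"
    using assms by (intro sum.mono_neutral_left) (auto simp: count_list_0_iff)
  finally show ?thesis .
qed

lemma sorted_Lambda: "sorted_wrt (\<ge>) (Lambda n l a)"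
  unfolding Lambda_word sorted_wrt_rev using sorted_sort by simp

lemma Lambda_in_partitions_ge:
  assumes "1 \<le> n" "1 \<le> l"
  shows "Lambda n l a \<in> partitions_ge (n + l - 1) l"
proof -
  let ?w = "word n l a"
  have "sum_list (Lambda n l a) = (\<Sum>v\<in>set ?w. count_list ?w v)"
    using excess_Lambda[of "set ?w" n l a 0] by (simp add: sum_list_excess_0)
  also have "\<dots> = length ?w" by (rule sum_count_set) simp_all
  also have "\<dots> = n + l - 1"
  proof -
    have "length ?w = l + (Suc n - 2)" by (simp only: word_def length_append length_replicate length_map length_upt)
    then show ?thesis using assms by linarith
  qed
  finally have sum: "sum_list (Lambda n l a) = n + l - 1" .
  have pos: "\<forall>p\<in>set (Lambda n l a). 0 < p"
    unfolding set_Lambda set_eq_count[of "word n l a"] by blast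
  have "Lambda n l a \<in> partitions (n + l - 1)"
    unfolding partitions_def using sum pos sorted_Lambda[of n l a] by blast
  moreover have "l \<le> hd (Lambda n l a)"
  proof -
    have "l \<le> count_list ?w (a 1)" by (simp add: word_def count_list_append count_list_eq_length_filter)
    moreover have "count_list ?w (a 1) \<in> set (Lambda n l a)"
      unfolding set_Lambda using assms by (intro imageI) (simp add: word_def)
    moreover have "\<forall>x\<in>set (Lambda n l a). x \<le> hd (Lambda n l a)"
      using sorted_Lambda[of n l a] by (cases "Lambda n l a") auto
    ultimately show ?thesis using le_trans[of l "count_list ?w (a 1)"] by blast
  qed
  ultimately show ?thesis by (simp add: partitions_ge_def)
qed

lemma count_word_extend:
  assumes "1 \<le> n"
  shows "count_list (word (Suc n) l (a(Suc n := w))) v = count_list (word n l a) v + of_bool (v = w)"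
proof -
  have "map (a(Suc n := w)) [2..<Suc n] = map a [2..<Suc n]" by (rule map_cong) auto
  moreover have "[2..<Suc (Suc n)] = [2..<Suc n] @ [Suc n]" using assms by simp
  ultimately have "word (Suc n) l (a(Suc n := w)) = word n l a @ [w]"
    using assms by (simp add: word_def del: upt_Suc)
  then show ?thesis by (simp add: count_list_append)
qed

text \<open>A new coordinate with value \<open>w\<close> enlarges by one the part that counts the occurrences
  of \<open>w\<close>.\<close>
lemma excess_Lambda_extend:
  assumes "1 \<le> n"
  shows "excess (Lambda (Suc n) l (a(Suc n := w))) t
       = excess (Lambda n l a) t + of_bool (t \<le> count_list (word n l a) w)"
proof -
  let ?c = "count_list (word n l a)"
  let ?V = "insert w (set (word n l a))"
  have "set (word (Suc n) l (a(Suc n := w))) \<subseteq> ?V"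
    unfolding set_eq_count count_word_extend[OF assms] by auto
  then have "excess (Lambda (Suc n) l (a(Suc n := w))) t = (\<Sum>v\<in>?V. ?c v + of_bool (v = w) - t)"
    by (subst excess_Lambda[of ?V]) (auto simp: count_word_extend[OF assms])
  also have "\<dots> = (\<Sum>v\<in>?V. (?c v - t) + of_bool (v = w \<and> t \<le> ?c w))"
    by (rule sum.cong) auto
  also have "\<dots> = (\<Sum>v\<in>?V. ?c v - t) + of_bool (t \<le> ?c w)"
    by (simp add: sum.distrib of_bool_conj flip: sum_distrib_right)
  also have "(\<Sum>v\<in>?V. ?c v - t) = excess (Lambda n l a) t"
    by (subst excess_Lambda[of ?V]) auto
  finally show ?thesis .
qed

text \<open>These are the values that will serve as roots. If \<open>\<Lambda>\<close> has more than \<open>d\<close> parts, take the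
  values whose multiplicity is at least the part with index \<open>d\<close>. Otherwise that part is
  zero by convention and all elements of the infinite field qualify.\<close>
lemma many_frequent_values:
  assumes "infinite (UNIV :: 'k set)"
  obtains V :: "'k set" where "finite V" "d < card V"
    "\<And>v. v \<in> V \<Longrightarrow> part (Lambda n l a) d \<le> count_list (word n l a) v"
proof (cases "d < length (Lambda n l a)")
  case True
  let ?w = "word n l a" and ?t = "part (Lambda n l a) d"
  let ?V = "{v \<in> set ?w. ?t \<le> count_list ?w v}"
  have "d < length (filter (\<lambda>x. ?t \<le> x) (Lambda n l a))"
    by (rule less_length_filter_le[OF sorted_Lambda True]) simp
  also have "\<dots> = size (filter_mset (\<lambda>x. ?t \<le> x) (mset (Lambda n l a)))"
    by (simp flip: mset_filter)
  also have "\<dots> = length (filter (\<lambda>x. ?t \<le> x) (map (count_list ?w) (remdups ?w)))"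
    by (simp only: mset_Lambda size_mset flip: mset_filter)
  also have "\<dots> = length (filter (\<lambda>v. ?t \<le> count_list ?w v) (remdups ?w))"
    by (simp add: filter_map o_def)
  also have "\<dots> = card (set (filter (\<lambda>v. ?t \<le> count_list ?w v) (remdups ?w)))"
    by (rule distinct_card[symmetric]) simp
  also have "set (filter (\<lambda>v. ?t \<le> count_list ?w v) (remdups ?w)) = ?V" by simp
  finally have "d < card ?V" .
  then show ?thesis by (intro that[of ?V]) auto
next
  case False
  obtain V :: "'k set" where "finite V" "card V = Suc d"
    using infinite_arbitrarily_large[OF assms] by blast
  then show ?thesis using False by (intro that[of V]) (auto simp: part_def)
qed

section \<open>Tableaux and Specht polynomials\<close>

lemma diagram_Sigma: "diagram \<nu> = (SIGMA i:{..<length \<nu>}. {..<\<nu> ! i})"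
  by (auto simp: diagram_def)

lemma finite_diagram [simp]: "finite (diagram \<nu>)"
  by (simp add: diagram_Sigma)

lemma card_diagram_right: "card {x \<in> diagram \<nu>. t \<le> snd x} = excess \<nu> t"
proof -
  have "{x \<in> diagram \<nu>. t \<le> snd x} = (SIGMA i:{..<length \<nu>}. {t..<\<nu> ! i})"
    by (auto simp: diagram_def)
  then show ?thesis
    by (simp add: card_SigmaI excess_def sum_list_sum_nth atLeast0LessThan)
qed

lemma card_diagram: "card (diagram \<nu>) = sum_list \<nu>"
  using card_diagram_right[of \<nu> 0] by (simp add: sum_list_excess_0)

lemma count_image_mset_set:
  "finite A \<Longrightarrow> count (image_mset f (mset_set A)) v = card {x \<in> A. f x = v}"
proof (induction A rule: finite_induct)
  case (insert x A)
  have "{y \<in> insert x A. f y = v} = (if f x = v then insert x {y \<in> A. f y = v} else {y \<in> A. f y = v})"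
    by auto
  then show ?case using insert by simp
qed simp

lemma card_Tab_fibre:
  assumes "T \<in> Tab n l \<nu>"
  shows "card {x \<in> diagram \<nu>. T x = v} = (if v = 1 then l else if v \<in> {2..n} then 1 else 0)"
proof -
  have "card {x \<in> diagram \<nu>. T x = v} = count (replicate_mset l 1 + mset_set {2..n}) v"
    using assms by (simp add: Tab_def flip: count_image_mset_set)
  then show ?thesis by (auto simp: count_mset_set)
qed

lemma Tab_range:
  assumes "T \<in> Tab n l \<nu>" "1 \<le> n" "x \<in> diagram \<nu>"
  shows "T x \<in> {1..n}"
proof -
  have "x \<in> {y \<in> diagram \<nu>. T y = T x}" using assms(3) by simp
  moreover have "finite {y \<in> diagram \<nu>. T y = T x}" by simp
  ultimately have "card {y \<in> diagram \<nu>. T y = T x} \<noteq> 0" by (metis card_0_eq empty_iff)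
  then show ?thesis using card_Tab_fibre[OF assms(1), of "T x"] assms(2) by (auto split: if_splits)
qed

lemma Tab_inj:
  assumes T: "T \<in> Tab n l \<nu>" and x: "x \<in> diagram \<nu>" and y: "y \<in> diagram \<nu>"
    and eq: "T x = T y" and ne: "T x \<noteq> 1"
  shows "x = y"
proof -
  let ?A = "{z \<in> diagram \<nu>. T z = T x}"
  have "card ?A \<le> Suc 0" using card_Tab_fibre[OF T, of "T x"] ne by simp
  moreover have "finite ?A" by simp
  ultimately have "\<forall>a\<in>?A. \<forall>b\<in>?A. a = b" using card_le_Suc0_iff_eq by blast
  moreover have "x \<in> ?A" using x by simp
  moreover have "y \<in> ?A" using y eq by simp
  ultimately show ?thesis by blast
qed

lemma Tab_column_inj:
  assumes T: "T \<in> Tab n l \<nu>" and x: "(i, j) \<in> diagram \<nu>" and y: "(i', j) \<in> diagram \<nu>"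
    and eq: "T (i, j) = T (i', j)"
  shows "i = i'"
proof (cases "T (i, j) = 1")
  case True
  moreover have "\<forall>i i' j. (i, j) \<in> diagram \<nu> \<longrightarrow> (i', j) \<in> diagram \<nu> \<longrightarrow>
      T (i, j) = 1 \<longrightarrow> T (i', j) = 1 \<longrightarrow> i = i'"
    using T unfolding Tab_def by blast
  ultimately show ?thesis using x y eq by metis
next
  case False
  have "(i, j) = (i', j)" by (rule Tab_inj[OF T x y eq False])
  then show ?thesis by simp
qed

definition column_pairs :: "nat list \<Rightarrow> (nat \<times> nat \<Rightarrow> nat) \<Rightarrow> (nat \<times> nat) set" where
  "column_pairs \<nu> T = {(a, b). a < b \<and> (\<exists>i i' j. (i, j) \<in> diagram \<nu> \<and> (i', j) \<in> diagram \<nu> \<and>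
     T (i, j) = a \<and> T (i', j) = b)}"

lemma column_pairsI:
  "(i, j) \<in> diagram \<nu> \<Longrightarrow> (i', j) \<in> diagram \<nu> \<Longrightarrow> T (i, j) < T (i', j) \<Longrightarrow>
     (T (i, j), T (i', j)) \<in> column_pairs \<nu> T"
  unfolding column_pairs_def mem_Collect_eq prod.case
  by (rule conjI, assumption, rule exI[of _ i], rule exI[of _ i'], rule exI[of _ j]) simp

lemma column_pairsE:
  assumes "y \<in> column_pairs \<nu> T"
  obtains i i' j where "y = (T (i, j), T (i', j))" "T (i, j) < T (i', j)"
    "(i, j) \<in> diagram \<nu>" "(i', j) \<in> diagram \<nu>"
proof -
  obtain a b where y: "y = (a, b)" by (cases y)
  have "a < b \<and> (\<exists>i i' j. (i, j) \<in> diagram \<nu> \<and> (i', j) \<in> diagram \<nu> \<and> T (i, j) = a \<and> T (i', j) = b)"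
    using assms unfolding column_pairs_def y mem_Collect_eq prod.case .
  then obtain i i' j where *: "a < b" "(i, j) \<in> diagram \<nu>" "(i', j) \<in> diagram \<nu>"
    "T (i, j) = a" "T (i', j) = b" by (elim conjE exE)
  show ?thesis using * by (intro that[of i j i']) (simp_all add: y)
qed

lemma column_pairs_upper:
  assumes "T \<in> Tab n l \<nu>" "1 \<le> n"
  shows "column_pairs \<nu> T \<subseteq> upper_pairs n"
proof
  fix x assume "x \<in> column_pairs \<nu> T"
  then obtain i i' j where x: "x = (T (i, j), T (i', j))" "T (i, j) < T (i', j)"
    "(i, j) \<in> diagram \<nu>" "(i', j) \<in> diagram \<nu>"
    by (rule column_pairsE)
  then show "x \<in> upper_pairs n"
    using Tab_range[OF assms x(3)] Tab_range[OF assms x(4)] by (simp add: upper_pairs_def)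
qed

definition pairs_of :: "nat set \<Rightarrow> (nat \<times> nat) set" where
  "pairs_of A = {(a, b). a < b \<and> a \<in> A \<and> b \<in> A}"

lemma finite_pairs_of [simp]: "finite A \<Longrightarrow> finite (pairs_of A)"
  by (rule finite_subset[of _ "A \<times> A"]) (auto simp: pairs_of_def)

lemma difference_product_snoc:
  "(difference_product (as @ [x]) :: 'k::field mpoly) =
     difference_product as * (\<Prod>i<length as. var (as ! i) - var x)"
proof -
  have "(\<Prod>j<length as. \<Prod>i<j. var ((as @ [x]) ! i) - var ((as @ [x]) ! j) :: 'k mpoly) =
      (\<Prod>j<length as. \<Prod>i<j. var (as ! i) - var (as ! j))"
    by (intro prod.cong refl) (simp add: nth_append)
  moreover have "(\<Prod>i<length as. var ((as @ [x]) ! i) - var x :: 'k mpoly) = (\<Prod>i<length as. var (as ! i) - var x)"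
    by (intro prod.cong refl) (simp add: nth_append)
  ultimately show ?thesis by (simp add: difference_product_def nth_append_length)
qed

text \<open>The entries of a column need not increase, so the two products agree only up to sign.\<close>
lemma difference_product_eq:
  assumes "distinct as"
  shows "\<exists>c\<in>{1, - 1}. (difference_product as :: 'k::field mpoly) = c * diff_prod (pairs_of (set as))"
  using assms
proof (induction as rule: rev_induct)
  case Nil
  then show ?case by (simp add: difference_product_def pairs_of_def diff_prod_def)
next
  case (snoc x as)
  let ?p = "\<lambda>a. if a < x then (a, x) else (x, a)"
  let ?f = "\<lambda>(a, b). var a - var b :: 'k mpoly"
  obtain c :: "'k mpoly" where c: "c \<in> {1, - 1}"
    "difference_product as = c * diff_prod (pairs_of (set as))"
    using snoc.IH snoc.prems by (metis distinct_append)
  have fac: "\<exists>e\<in>{1, - 1}. (\<Prod>a\<in>A. var a - var x :: 'k mpoly) = e * (\<Prod>a\<in>A. ?f (?p a))"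
    if "finite A" for A
    using that
  proof (induction A rule: finite_induct)
    case empty
    show ?case by simp
  next
    case (insert a A)
    then obtain e :: "'k mpoly" where e: "e \<in> {1, - 1}"
      "(\<Prod>a\<in>A. var a - var x) = e * (\<Prod>a\<in>A. ?f (?p a))" by blast
    have "var a - var x = (if a < x then 1 else - 1) * (?f (?p a))"
      by simp
    then have "(\<Prod>a\<in>insert a A. var a - var x) =
        ((if a < x then 1 else - 1) * e) * (\<Prod>a\<in>insert a A. ?f (?p a))"
      using insert.hyps e(2) by (simp add: mult_ac)
    moreover have "(if a < x then 1 else - 1) * e \<in> {1, - 1}" using e(1) by auto
    ultimately show ?case by blast
  qed
  have "(\<Prod>i<length as. var (as ! i) - var x) = (\<Prod>a\<in>set as. var a - var x :: 'k mpoly)"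
    using snoc.prems by (intro prod.reindex_bij_betw[OF bij_betw_nth]) auto
  moreover obtain e :: "'k mpoly" where e: "e \<in> {1, - 1}"
    "(\<Prod>a\<in>set as. var a - var x) = e * (\<Prod>a\<in>set as. ?f (?p a))"
    using fac[of "set as"] by blast
  moreover have "(\<Prod>a\<in>set as. ?f (?p a)) = diff_prod (?p ` set as)"
    unfolding diff_prod_def by (subst prod.reindex) (auto simp: inj_on_def split: if_splits)
  moreover have "diff_prod (pairs_of (set (as @ [x]))) =
      (diff_prod (pairs_of (set as)) * diff_prod (?p ` set as) :: 'k mpoly)"
  proof -
    have "pairs_of (set (as @ [x])) = pairs_of (set as) \<union> ?p ` set as"
      using snoc.prems by (auto simp: pairs_of_def image_iff) (metis linorder_neqE_nat)
    moreover have "pairs_of (set as) \<inter> ?p ` set as = {}"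
      using snoc.prems by (auto simp: pairs_of_def split: if_splits)
    ultimately show ?thesis by (simp add: diff_prod_def prod.union_disjoint)
  qed
  ultimately have "difference_product (as @ [x]) = (c * e) * diff_prod (pairs_of (set (as @ [x])))"
    using c(2) by (simp add: difference_product_snoc mult_ac)
  moreover have "c * e \<in> {1, - 1}" using c(1) e(1) by auto
  ultimately show ?case by blast
qed

lemma set_column: "set (column \<nu> T j) = {T (i, j) | i. (i, j) \<in> diagram \<nu>}"
  by (auto simp: column_def diagram_def)

text \<open>No pair is contributed by two different columns: of two distinct entries at least one
  differs from 1 and hence occurs only once in the tableau.\<close>
lemma specht_eq_diff_prod:
  assumes T: "T \<in> Tab n l \<nu>" and \<nu>: "sorted_wrt (\<ge>) \<nu>"
  shows "\<exists>c\<in>{1, - 1}. (specht \<nu> T :: 'k::field mpoly) = c * diff_prod (column_pairs \<nu> T)"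
proof -
  let ?C = "\<lambda>j. pairs_of (set (column \<nu> T j))"
  have dist: "distinct (column \<nu> T j)" for j
    unfolding column_def distinct_map using Tab_column_inj[OF T] by (auto simp: inj_on_def)
  have "\<exists>c\<in>{1, - 1}. (\<Prod>j\<in>J. difference_product (column \<nu> T j) :: 'k mpoly) = c * (\<Prod>j\<in>J. diff_prod (?C j))"
    if "finite J" for J
    using that
  proof (induction J rule: finite_induct)
    case empty
    show ?case by simp
  next
    case (insert j J)
    then obtain c :: "'k mpoly" where c: "c \<in> {1, - 1}"
      "(\<Prod>j\<in>J. difference_product (column \<nu> T j)) = c * (\<Prod>j\<in>J. diff_prod (?C j))" by blast
    obtain e :: "'k mpoly" where e: "e \<in> {1, - 1}"
      "difference_product (column \<nu> T j) = e * diff_prod (?C j)"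
      using difference_product_eq[OF dist] by blast
    have "(\<Prod>j\<in>insert j J. difference_product (column \<nu> T j)) = (e * c) * (\<Prod>j\<in>insert j J. diff_prod (?C j))"
      using insert.hyps c(2) e(2) by (simp add: mult_ac)
    moreover have "e * c \<in> {1, - 1}" using c(1) e(1) by auto
    ultimately show ?case by blast
  qed
  then obtain c :: "'k mpoly" where c: "c \<in> {1, - 1}" "specht \<nu> T = c * (\<Prod>j<hd \<nu>. diff_prod (?C j))"
    unfolding specht_def by blast
  have disj: "?C j \<inter> ?C k = {}" if "j \<noteq> k" for j k
  proof (rule ccontr)
    assume "?C j \<inter> ?C k \<noteq> {}"
    then obtain a b where ab: "a < b" "a \<in> set (column \<nu> T j)" "b \<in> set (column \<nu> T j)"
      "a \<in> set (column \<nu> T k)" "b \<in> set (column \<nu> T k)"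
      by (auto simp: pairs_of_def)
    then obtain i i' i1 i1' where *: "(i, j) \<in> diagram \<nu>" "T (i, j) = b" "(i', k) \<in> diagram \<nu>" "T (i', k) = b"
      "(i1, j) \<in> diagram \<nu>" "T (i1, j) = a" "(i1', k) \<in> diagram \<nu>" "T (i1', k) = a"
      unfolding set_column by auto
    show False
    proof (cases "b = 1")
      case True
      then have "a \<noteq> 1" using ab(1) by simp
      then show False using Tab_inj[OF T *(5,7)] * that by simp
    next
      case False
      then show False using Tab_inj[OF T *(1,3)] * that by simp
    qed
  qed
  have "(\<Prod>j<hd \<nu>. diff_prod (?C j) :: 'k mpoly) = diff_prod (\<Union>j<hd \<nu>. ?C j)"
    unfolding diff_prod_def by (rule prod.UNION_disjoint[symmetric]) (use disj in auto)
  also have "(\<Union>j<hd \<nu>. ?C j) = column_pairs \<nu> T"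
  proof -
    have "j < hd \<nu>" if "(i, j) \<in> diagram \<nu>" for i j
    proof -
      have "part \<nu> i \<le> part \<nu> 0" by (rule part_antimono[OF \<nu>]) simp
      then show ?thesis using that by (cases \<nu>) (auto simp: part_def diagram_def)
    qed
    then show ?thesis unfolding column_pairs_def pairs_of_def set_column by blast
  qed
  finally show ?thesis using c by auto
qed

lemma Delta_eq_diff_prod: "Delta m = (diff_prod (upper_pairs m) :: 'k::field mpoly)"
proof -
  have "(diff_prod (upper_pairs m) :: 'k mpoly) = (\<Prod>(j, i)\<in>(SIGMA j:{1..m}. {1..<j}). var i - var j)"
    unfolding diff_prod_def
    by (rule prod.reindex_bij_witness[of _ prod.swap prod.swap]) (auto simp: upper_pairs_def)
  then show ?thesis by (simp add: Delta_def prod.Sigma)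
qed

text \<open>If equal values of \<open>\<alpha>\<close> never meet in a column, then a value that occurs \<open>c\<close> times has at
  least \<open>c - t\<close> of its occurrences to the right of the first \<open>t\<close> columns. Summing over all
  values bounds the excess of \<open>\<Lambda>\<close> by the number of boxes there.\<close>
lemma excess_Lambda_le_excess_shape:
  assumes T: "T \<in> Tab n l \<nu>" and n: "1 \<le> n"
    and sep: "\<And>a b. (a, b) \<in> column_pairs \<nu> T \<Longrightarrow> \<alpha> a \<noteq> \<alpha> b"
  shows "excess (Lambda n l \<alpha>) t \<le> excess \<nu> t"
proof -
  let ?D = "diagram \<nu>"
  let ?B = "\<lambda>v. {x \<in> ?D. \<alpha> (T x) = v}"
  let ?R = "\<lambda>v. {x \<in> ?D. \<alpha> (T x) = v \<and> t \<le> snd x}"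
  have "mset (word n l \<alpha>) = image_mset \<alpha> (replicate_mset l 1 + mset_set {2..n})"
    by (simp add: word_def mset_upt atLeastLessThanSuc_atLeastAtMost del: upt_Suc)
  also have "\<dots> = image_mset \<alpha> (image_mset T (mset_set ?D))"
    using T by (simp add: Tab_def)
  also have "\<dots> = image_mset (\<lambda>x. \<alpha> (T x)) (mset_set ?D)" by (simp add: multiset.map_comp o_def)
  finally have cnt: "count_list (word n l \<alpha>) v = card (?B v)" for v
    by (simp add: count_image_mset_set flip: count_mset)
  have inj: "inj_on snd (?B v)" for v
  proof (rule inj_onI)
    fix x y assume x: "x \<in> ?B v" and y: "y \<in> ?B v" and eq: "snd x = snd y"
    obtain i i' j where xy: "x = (i, j)" "y = (i', j)" using eq by (cases x; cases y) auto
    have D: "(i, j) \<in> ?D" "(i', j) \<in> ?D" "\<alpha> (T (i, j)) = \<alpha> (T (i', j))" using x y by (simp_all add: xy)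
    have "T (i, j) = T (i', j)"
    proof (rule linorder_cases)
      assume "T (i, j) < T (i', j)"
      then have "(T (i, j), T (i', j)) \<in> column_pairs \<nu> T" using D by (intro column_pairsI)
      then show ?thesis using sep D(3) by blast
    next
      assume "T (i', j) < T (i, j)"
      then have "(T (i', j), T (i, j)) \<in> column_pairs \<nu> T" using D by (intro column_pairsI)
      then show ?thesis using sep D(3) by force
    qed
    then show "x = y" using Tab_column_inj[OF T D(1,2)] by (simp add: xy)
  qed
  have le: "card (?B v) - t \<le> card (?R v)" for v
  proof -
    have "?B v \<subseteq> ?R v \<union> {x \<in> ?B v. snd x < t}" by auto
    then have "card (?B v) \<le> card (?R v \<union> {x \<in> ?B v. snd x < t})" by (intro card_mono) auto
    also have "\<dots> \<le> card (?R v) + card {x \<in> ?B v. snd x < t}" by (rule card_Un_le)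
    also have "card {x \<in> ?B v. snd x < t} \<le> card {..<t}"
      by (rule card_inj_on_le[of snd]) (auto intro: inj_on_subset[OF inj[of v]])
    finally show ?thesis by simp
  qed
  let ?S = "set (word n l \<alpha>)"
  have "excess (Lambda n l \<alpha>) t = (\<Sum>v\<in>?S. card (?B v) - t)"
    by (subst excess_Lambda[of ?S]) (auto simp: cnt)
  also have "\<dots> \<le> (\<Sum>v\<in>?S. card (?R v))" by (intro sum_mono le)
  also have "\<dots> = card (\<Union>v\<in>?S. ?R v)"
    by (rule card_UN_disjoint[symmetric]) auto
  also have "\<dots> \<le> card {x \<in> ?D. t \<le> snd x}" by (rule card_mono) auto
  also have "\<dots> = excess \<nu> t" by (rule card_diagram_right)
  finally show ?thesis .
qed

lemma diagram_add_box:
  assumes "r \<le> length \<nu>"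
  shows "diagram (add_box \<nu> r) = insert (r, part \<nu> r) (diagram \<nu>)"
  using assms by (auto simp: diagram_def add_box_def part_def nth_append nth_list_update less_Suc_eq split: if_splits)

lemma Tab_extend:
  assumes T: "T \<in> Tab n l \<nu>" and n: "1 \<le> n" and r: "r \<le> length \<nu>"
  shows "T((r, part \<nu> r) := Suc n) \<in> Tab (Suc n) l (add_box \<nu> r)"
proof -
  let ?x = "(r, part \<nu> r)" let ?T = "T(?x := Suc n)"
  have x: "?x \<notin> diagram \<nu>" by (auto simp: diagram_def part_def)
  have "image_mset ?T (mset_set (diagram \<nu>)) = image_mset T (mset_set (diagram \<nu>))"
    using x by (intro image_mset_cong) auto
  moreover have "{2..Suc n} = insert (Suc n) {2..n}" using n by auto
  ultimately have "image_mset ?T (mset_set (insert ?x (diagram \<nu>))) = replicate_mset l 1 + mset_set {2..Suc n}"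
    using x T by (simp add: Tab_def)
  moreover have "?T \<in> extensional (insert ?x (diagram \<nu>))" using T by (auto simp: Tab_def extensional_def)
  moreover have "i = i'" if "(i, j) \<in> insert ?x (diagram \<nu>)" "(i', j) \<in> insert ?x (diagram \<nu>)"
    "?T (i, j) = 1" "?T (i', j) = 1" for i i' j
  proof -
    have "(i, j) \<noteq> ?x" "(i', j) \<noteq> ?x" using that(3,4) n by auto
    then show ?thesis using that T by (auto simp: Tab_def)
  qed
  ultimately show ?thesis unfolding Tab_def diagram_add_box[OF r] by blast
qed

text \<open>The new box lies at the bottom of its column, below exactly the rows longer than row
  \<open>r\<close>.\<close>
lemma column_pairs_extend:
  assumes T: "T \<in> Tab n l \<nu>" and n: "1 \<le> n" and \<nu>: "sorted_wrt (\<ge>) \<nu>" and r: "r \<le> length \<nu>"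
  shows "column_pairs (add_box \<nu> r) (T((r, part \<nu> r) := Suc n))
       \<subseteq> column_pairs \<nu> T \<union> (\<lambda>i. (T (i, part \<nu> r), Suc n)) ` {..<r}"
proof
  let ?x = "(r, part \<nu> r)" let ?T = "T(?x := Suc n)"
  fix y assume "y \<in> column_pairs (add_box \<nu> r) ?T"
  then obtain i i' j where y: "y = (?T (i, j), ?T (i', j))" "?T (i, j) < ?T (i', j)"
    "(i, j) \<in> insert ?x (diagram \<nu>)" "(i', j) \<in> insert ?x (diagram \<nu>)"
    unfolding diagram_add_box[OF r, symmetric] by (rule column_pairsE)
  have le: "?T z \<le> Suc n" if "z \<in> insert ?x (diagram \<nu>)" for z
    using that Tab_range[OF T n, of z] by auto
  have ne: "(i, j) \<noteq> ?x" using y(2) le[OF y(4)] by auto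
  then have D: "(i, j) \<in> diagram \<nu>" using y(3) by blast
  show "y \<in> column_pairs \<nu> T \<union> (\<lambda>i. (T (i, part \<nu> r), Suc n)) ` {..<r}"
  proof (cases "(i', j) = ?x")
    case True
    have "i < r"
    proof (rule ccontr)
      assume "\<not> i < r"
      then have "part \<nu> i \<le> part \<nu> r" by (intro part_antimono[OF \<nu>]) simp
      then show False using D True by (auto simp: diagram_def part_def split: if_splits)
    qed
    then show ?thesis using True ne y(1) by auto
  next
    case False
    then have "(T (i, j), T (i', j)) \<in> column_pairs \<nu> T"
      using y D ne by (intro column_pairsI) auto
    moreover have "y = (T (i, j), T (i', j))"
      unfolding y(1) fun_upd_other[OF ne] fun_upd_other[OF False] ..
    ultimately have "y \<in> column_pairs \<nu> T" by simp
    then show ?thesis by blast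
  qed
qed

lemma Tab_nonempty:
  assumes \<nu>: "\<nu> \<in> partitions_ge (n + l - 1) l" and n: "1 \<le> n" and l: "1 \<le> l"
  shows "\<exists>T. T \<in> Tab n l \<nu>"
proof -
  \<comment> \<open>The entries 1 go into the first \<open>l\<close> boxes of the first row.\<close>
  let ?D = "diagram \<nu>" and ?O = "(\<lambda>j. (0::nat, j)) ` {..<l}"
  have "\<nu> \<noteq> []" using \<nu> n l partitions_nonempty[of \<nu> "n + l - 1"] by (auto simp: partitions_ge_def)
  then have O: "?O \<subseteq> ?D" using \<nu> by (auto simp: diagram_def partitions_ge_def hd_conv_nth)
  have cO: "card ?O = l" by (simp add: card_image inj_on_def)
  have "card ?D = n + l - 1" using \<nu> by (simp add: card_diagram partitions_ge_def partitions_def)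
  then have "card (?D - ?O) = card {2..n}" using O cO l n by (simp add: card_Diff_subset)
  then obtain h where h: "bij_betw h (?D - ?O) {2..n}"
    using finite_same_card_bij[of "?D - ?O" "{2..n}"] by auto
  define T where "T = (\<lambda>x. if x \<in> ?O then 1 else if x \<in> ?D then h x else undefined)"
  have "mset_set ?D = mset_set ?O + mset_set (?D - ?O)"
    using O mset_set_Union[of ?O "?D - ?O"] by (simp add: Un_absorb1)
  moreover have "image_mset T (mset_set ?O) = replicate_mset l 1"
  proof -
    have "image_mset T (mset_set ?O) = image_mset (\<lambda>_. 1) (mset_set ?O)"
      by (rule image_mset_cong) (simp add: T_def)
    then show ?thesis by (simp add: image_mset_const_eq cO)
  qed
  moreover have "image_mset T (mset_set (?D - ?O)) = mset_set {2..n}"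
  proof -
    have "image_mset T (mset_set (?D - ?O)) = image_mset h (mset_set (?D - ?O))"
      by (rule image_mset_cong) (simp add: T_def)
    also have "\<dots> = mset_set (h ` (?D - ?O))"
      using h by (intro image_mset_mset_set) (simp add: bij_betw_def)
    finally show ?thesis using h by (simp add: bij_betw_def)
  qed
  ultimately have "image_mset T (mset_set ?D) = replicate_mset l 1 + mset_set {2..n}" by simp
  moreover have "T \<in> extensional ?D" using O by (auto simp: T_def extensional_def)
  moreover have "i = 0" if "(i, j) \<in> ?D" "T (i, j) = 1" for i j
  proof (rule ccontr)
    assume "i \<noteq> 0"
    then have x: "(i, j) \<in> ?D - ?O" using that by auto
    then have "T (i, j) = h (i, j)" by (simp add: T_def)
    moreover have "h (i, j) \<in> {2..n}" using h x by (auto simp: bij_betw_def)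
    ultimately show False using that(2) by simp
  qed
  ultimately have "T \<in> Tab n l \<nu>" unfolding Tab_def by blast
  then show ?thesis by blast
qed

lemma finite_Tab:
  assumes "1 \<le> n"
  shows "finite (Tab n l \<nu>)"
proof (rule finite_subset)
  show "Tab n l \<nu> \<subseteq> diagram \<nu> \<rightarrow>\<^sub>E {1..n}"
  proof
    fix T assume T: "T \<in> Tab n l \<nu>"
    have "T x \<in> {1..n}" if "x \<in> diagram \<nu>" for x by (rule Tab_range[OF T assms that])
    then show "T \<in> diagram \<nu> \<rightarrow>\<^sub>E {1..n}" using T by (simp add: Tab_def PiE_def)
  qed
qed (simp add: finite_PiE)

lemma finite_partitions: "finite (partitions N)"
proof (rule finite_subset)
  show "partitions N \<subseteq> {xs. set xs \<subseteq> {..N} \<and> length xs \<le> N}"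
  proof
    fix \<nu> assume \<nu>: "\<nu> \<in> partitions N"
    have "x \<le> N" if "x \<in> set \<nu>" for x
      using member_le_sum_list[OF that] \<nu> by (simp add: partitions_def)
    moreover have "length xs \<le> sum_list xs" if "\<forall>p\<in>set xs. 0 < p" for xs :: "nat list"
      using that by (induction xs) auto
    then have "length \<nu> \<le> N" using \<nu> by (auto simp: partitions_def)
    ultimately show "\<nu> \<in> {xs. set xs \<subseteq> {..N} \<and> length xs \<le> N}" by auto
  qed
  show "finite {xs. set xs \<subseteq> {..N} \<and> length xs \<le> N}" by (rule finite_lists_length_le) simp
qed

section \<open>Leading monomials of the vanishing ideal\<close>

text \<open>The leading monomial of \<^const>\<open>diff_prod\<close>.\<close>
definition weight :: "(nat \<times> nat) set \<Rightarrow> (nat \<Rightarrow>\<^sub>0 nat)" where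
  "weight A = (\<Sum>(a, b)\<in>A. single b 1)"

lemma weight_subset:
  assumes "finite B" "A \<subseteq> B"
  shows "\<exists>u. weight B = weight A + u"
proof
  show "weight B = weight A + weight (B - A)"
    unfolding weight_def by (simp only: sum.subset_diff[OF assms(2,1)] add.commute)
qed

lemma weight_Un:
  "finite A \<Longrightarrow> finite B \<Longrightarrow> A \<inter> B = {} \<Longrightarrow> weight (A \<union> B) = weight A + weight B"
  by (simp add: weight_def sum.union_disjoint)

lemma sum_single_const: "finite B \<Longrightarrow> (\<Sum>x\<in>B. single N (1::nat)) = single N (card B)"
  by (induction B rule: finite_induct) (auto simp flip: single_add)

lemma weight_const:
  assumes "finite B" "snd ` B \<subseteq> {N}"
  shows "weight B = single N (card B)"
proof -
  have "weight B = (\<Sum>x\<in>B. single N 1)"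
    unfolding weight_def using assms(2) by (intro sum.cong) auto
  then show ?thesis by (simp only: sum_single_const[OF assms(1)])
qed

text \<open>The points at which the elements of \<^const>\<open>Jm_ideal\<close>, taken for the complement of
  \<open>F\<close>, vanish.\<close>
definition vanishing_point :: "nat \<Rightarrow> nat \<Rightarrow> nat \<Rightarrow> nat list set \<Rightarrow> (nat \<Rightarrow> 'k) \<Rightarrow> bool" where
  "vanishing_point n l m F \<alpha> \<longleftrightarrow> Lambda n l \<alpha> \<notin> F \<or> (\<exists>a b. (a, b) \<in> upper_pairs m \<and> \<alpha> a = \<alpha> b)"

lemma upper_pairs_mono: "m \<le> n \<Longrightarrow> upper_pairs m \<subseteq> upper_pairs n"
  by (auto simp: upper_pairs_def)

text \<open>For \<open>m = n\<close> every pair of variables already occurs in \<open>\<Delta>\<^sub>n\<close>, so any tableau whose shape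
  is in \<open>F\<close> will do.\<close>
lemma leading_monomial_divisible_base:
  fixes f :: "'k::field mpoly"
  assumes inf: "infinite (UNIV :: 'k set)" and l: "1 \<le> l" and n: "1 \<le> n"
    and F: "F \<subseteq> partitions_ge (n + l - 1) l"
    and f: "f \<in> polys n" "f \<noteq> 0"
    and van: "\<And>\<alpha>. vanishing_point n l n F \<alpha> \<Longrightarrow> poly_eval \<alpha> f = 0"
  shows "\<exists>\<nu>\<in>F. \<exists>T\<in>Tab n l \<nu>. \<exists>u. leading_monomial f = weight (column_pairs \<nu> T \<union> upper_pairs n) + u"
proof -
  have "F \<noteq> {}"
    using vanishing_imp_zero[OF inf f(1)] van f(2) by (auto simp: vanishing_point_def)
  then obtain \<nu> where \<nu>: "\<nu> \<in> F" by blast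
  then obtain T where T: "T \<in> Tab n l \<nu>" using Tab_nonempty[OF _ n l] F by blast
  obtain q where q: "q \<in> polys n" "f = diff_prod (upper_pairs n) * q"
    using diff_prod_divides[OF inf subset_refl f(1)] van unfolding vanishing_point_def by blast
  then have "q \<noteq> 0" using f(2) by auto
  then have "leading_monomial f = weight (upper_pairs n) + leading_monomial q"
    using diff_prod_nonzero[OF subset_refl, of n, where 'k='k]
    by (simp add: q(2) leading_monomial_mult leading_monomial_diff_prod[OF subset_refl] weight_def)
  moreover have "column_pairs \<nu> T \<union> upper_pairs n = upper_pairs n"
    using column_pairs_upper[OF T n] by blast
  ultimately show ?thesis using \<nu> T by metis
qed

text \<open>If \<open>\<alpha>\<close> has a coincidence among its first \<open>m\<close> coordinates, every value of the new
  coordinate is a root. Otherwise the frequent values are: giving the new coordinate such a value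
  enlarges a part at least as long as part \<open>d\<close>, and so leads at least as high up in the dominance
  order as a partition that is already outside \<open>F\<close>.\<close>
lemma leading_coefficient_vanishes:
  fixes f :: "'k::field mpoly"
  assumes inf: "infinite (UNIV :: 'k set)" and l: "1 \<le> l" and n: "1 \<le> n" and m: "m \<le> n"
    and F: "excess_filter (Suc n + l - 1) l F"
    and van: "\<And>\<alpha>. vanishing_point (Suc n) l m F \<alpha> \<Longrightarrow> poly_eval \<alpha> f = 0"
    and vp: "vanishing_point n l m (lead_filter (n + l - 1) l d F) \<alpha>"
  shows "\<exists>V. finite V \<and> d < card V \<and> (\<forall>v\<in>V. poly_eval (\<alpha>(Suc n := v)) f = 0)"
proof (cases "\<exists>a b. (a, b) \<in> upper_pairs m \<and> \<alpha> a = \<alpha> b")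
  case True
  then obtain a b where ab: "(a, b) \<in> upper_pairs m" "\<alpha> a = \<alpha> b" by blast
  obtain V :: "'k set" where V: "finite V" "card V = Suc d"
    using infinite_arbitrarily_large[OF inf] by blast
  have "poly_eval (\<alpha>(Suc n := v)) f = 0" for v
  proof (rule van)
    have "(\<alpha>(Suc n := v)) a = (\<alpha>(Suc n := v)) b" using ab m by (auto simp: upper_pairs_def)
    then show "vanishing_point (Suc n) l m F (\<alpha>(Suc n := v))" using ab(1) unfolding vanishing_point_def by blast
  qed
  then show ?thesis using V by (intro exI[of _ V]) simp
next
  case False
  let ?\<mu> = "Lambda n l \<alpha>"
  have N: "1 \<le> n + l - 1" "Suc (n + l - 1) = Suc n + l - 1" using n l by auto
  have \<mu>: "?\<mu> \<in> partitions_ge (n + l - 1) l" by (rule Lambda_in_partitions_ge[OF n l])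
  have "?\<mu> \<notin> lead_filter (n + l - 1) l d F" using vp False by (auto simp: vanishing_point_def)
  then have notF: "add_box ?\<mu> (corner ?\<mu> d) \<notin> F" using \<mu> by (simp add: lead_filter_def)
  have P: "add_box ?\<mu> (corner ?\<mu> d) \<in> partitions_ge (Suc n + l - 1) l"
    using add_box_partitions_ge[OF \<mu> N(1), of d] unfolding N(2) .
  obtain V :: "'k set" where V: "finite V" "d < card V"
    "\<And>v. v \<in> V \<Longrightarrow> part ?\<mu> d \<le> count_list (word n l \<alpha>) v"
    using many_frequent_values[OF inf] by metis
  have "poly_eval (\<alpha>(Suc n := v)) f = 0" if v: "v \<in> V" for v
  proof (rule van)
    have "excess (add_box ?\<mu> (corner ?\<mu> d)) t \<le> excess (Lambda (Suc n) l (\<alpha>(Suc n := v))) t" for t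
      using V(3)[OF v] by (simp add: excess_add_box corner_le_length part_corner excess_Lambda_extend[OF n])
    then have "Lambda (Suc n) l (\<alpha>(Suc n := v)) \<notin> F"
      using F P notF unfolding excess_filter_def by blast
    then show "vanishing_point (Suc n) l m F (\<alpha>(Suc n := v))" by (simp add: vanishing_point_def)
  qed
  then show ?thesis using V by blast
qed

text \<open>Placing \<open>n + 1\<close> in row \<open>r\<close> creates at most \<open>r \<le> d\<close> new pairs, all with larger member
  \<open>n + 1\<close>, so the leading monomial grows by at most \<open>x\<^sub>n\<^sub>+\<^sub>1\<^sup>d\<close>.\<close>
lemma weight_extend:
  assumes T: "T \<in> Tab n l \<nu>" and n: "1 \<le> n" and m: "m \<le> n" and \<nu>: "sorted_wrt (\<ge>) \<nu>"
    and r: "r \<le> length \<nu>" "r \<le> d"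
  shows "\<exists>u. weight (column_pairs \<nu> T \<union> upper_pairs m) + single (Suc n) d =
    weight (column_pairs (add_box \<nu> r) (T((r, part \<nu> r) := Suc n)) \<union> upper_pairs m) + u"
proof -
  let ?A = "column_pairs \<nu> T \<union> upper_pairs m"
  let ?B = "(\<lambda>i. (T (i, part \<nu> r), Suc n)) ` {..<r}"
  let ?C = "column_pairs (add_box \<nu> r) (T((r, part \<nu> r) := Suc n)) \<union> upper_pairs m"
  have A: "?A \<subseteq> upper_pairs n" using column_pairs_upper[OF T n] upper_pairs_mono[OF m] by blast
  then have finA: "finite ?A" by (rule finite_subset) simp
  have AB: "?A \<inter> ?B = {}" using A by (auto simp: upper_pairs_def)
  have "card ?B \<le> d" using card_image_le[of "{..<r}" "\<lambda>i. (T (i, part \<nu> r), Suc n)"] r(2) by simp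
  then have d: "single (Suc n) d = single (Suc n) (card ?B) + single (Suc n) (d - card ?B)"
    by (simp flip: single_add)
  have W1: "weight (?A \<union> ?B) = weight ?A + single (Suc n) (card ?B)"
  proof -
    have "finite ?B" "snd ` ?B \<subseteq> {Suc n}" by (simp_all add: image_subset_iff)
    then show ?thesis using weight_Un[OF finA _ AB] weight_const[of ?B "Suc n"] by simp
  qed
  have fin: "finite (?A \<union> ?B)" using finA by simp
  have "?C \<subseteq> ?A \<union> ?B"
    using column_pairs_extend[OF T n \<nu> r(1)] by (rule Un_mono[THEN order_trans, OF _ subset_refl]) auto
  from weight_subset[OF fin this] obtain u where W2: "weight (?A \<union> ?B) = weight ?C + u" by (rule exE)
  have "weight ?A + single (Suc n) d = weight (?A \<union> ?B) + single (Suc n) (d - card ?B)"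
    unfolding d W1 by (simp only: add.assoc)
  also have "\<dots> = weight ?C + (u + single (Suc n) (d - card ?B))"
    unfolding W2 by (simp only: add.assoc)
  finally show ?thesis by (rule exI)
qed

text \<open>The induction runs over all filters at once, because the passage from \<open>f\<close> to its leading
  coefficient replaces \<open>F\<close> by \<^const>\<open>lead_filter\<close>.\<close>
lemma leading_monomial_divisible:
  fixes f :: "'k::field mpoly"
  assumes inf: "infinite (UNIV :: 'k set)" and l: "1 \<le> l" and m: "1 \<le> m" and "m \<le> n"
    and "excess_filter (n + l - 1) l F" and "f \<in> polys n" "f \<noteq> 0"
    and "\<And>\<alpha>. vanishing_point n l m F \<alpha> \<Longrightarrow> poly_eval \<alpha> f = 0"
  shows "\<exists>\<nu>\<in>F. \<exists>T\<in>Tab n l \<nu>. \<exists>u. leading_monomial f = weight (column_pairs \<nu> T \<union> upper_pairs m) + u"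
  using assms(4-)
proof (induction n arbitrary: F f rule: dec_induct)
  case base
  then show ?case using inf l m
    by (intro leading_monomial_divisible_base) (simp_all add: excess_filter_def)
next
  case (step n)
  have n: "1 \<le> n" using m step.hyps(1) by simp
  have N: "1 \<le> n + l - 1" "Suc (n + l - 1) = Suc n + l - 1" using n l by auto
  obtain g d where g: "g \<in> polys n" "g \<noteq> 0"
    and lm: "leading_monomial f = leading_monomial g + single (Suc n) d"
    and roots: "\<And>a V. finite V \<Longrightarrow> d < card V \<Longrightarrow> \<forall>v\<in>V. poly_eval (a(Suc n := v)) f = 0 \<Longrightarrow> poly_eval a g = 0"
    using leading_coefficient[OF step.prems(2,3)] by metis
  let ?F = "lead_filter (n + l - 1) l d F"
  have filt: "excess_filter (n + l - 1) l ?F"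
    using step.prems(1) N by (intro excess_filter_lead_filter) simp_all
  have van: "poly_eval \<alpha> g = 0" if "vanishing_point n l m ?F \<alpha>" for \<alpha>
    using leading_coefficient_vanishes[OF inf l n step.hyps(1) step.prems(1,4) that] roots[of _ \<alpha>] by blast
  obtain \<nu> T u where \<nu>: "\<nu> \<in> ?F" and T: "T \<in> Tab n l \<nu>"
    and u: "leading_monomial g = weight (column_pairs \<nu> T \<union> upper_pairs m) + u"
    using step.IH[OF filt g van] by blast
  let ?r = "corner \<nu> d"
  let ?\<nu> = "add_box \<nu> ?r" and ?T = "T((?r, part \<nu> ?r) := Suc n)"
  have srt: "sorted_wrt (\<ge>) \<nu>" using \<nu> by (simp add: lead_filter_def partitions_ge_def partitions_def)
  obtain w where w: "weight (column_pairs \<nu> T \<union> upper_pairs m) + single (Suc n) d =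
      weight (column_pairs ?\<nu> ?T \<union> upper_pairs m) + w"
    using weight_extend[OF T n step.hyps(1) srt corner_le_length corner_le] by blast
  show ?case
  proof (rule bexI[of _ ?\<nu>], rule bexI[of _ ?T], rule exI[of _ "w + u"])
    have "leading_monomial f = (weight (column_pairs \<nu> T \<union> upper_pairs m) + single (Suc n) d) + u"
      unfolding lm u by (simp only: add_ac)
    then show "leading_monomial f = weight (column_pairs ?\<nu> ?T \<union> upper_pairs m) + (w + u)"
      unfolding w by (simp only: add.assoc)
    show "?T \<in> Tab (Suc n) l ?\<nu>" by (rule Tab_extend[OF T n corner_le_length])
    show "?\<nu> \<in> F" using \<nu> by (simp add: lead_filter_def)
  qed
qed

section \<open>Least common multiples\<close>

lemma divides_poly_ring: "p divides\<^bsub>poly_ring n\<^esub> q \<longleftrightarrow> (\<exists>r\<in>polys n. q = p * r)"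
  by (simp add: factor_def)

lemma diff_prod_lcm:
  fixes T :: "nat \<times> nat \<Rightarrow> nat"
  assumes inf: "infinite (UNIV :: 'k::field set)" and T: "T \<in> Tab n l \<nu>" and \<nu>: "sorted_wrt (\<ge>) \<nu>"
    and n: "1 \<le> n" and m: "m \<le> n"
  shows "(diff_prod (column_pairs \<nu> T \<union> upper_pairs m) :: 'k mpoly) lcmof\<^bsub>poly_ring n\<^esub> (specht \<nu> T) (Delta m)"
proof -
  let ?A = "column_pairs \<nu> T" and ?U = "upper_pairs m"
  have AU: "?A \<subseteq> upper_pairs n" "?U \<subseteq> upper_pairs n" "?A \<union> ?U \<subseteq> upper_pairs n"
    using column_pairs_upper[OF T n] upper_pairs_mono[OF m] by auto
  have fin: "finite ?A" using AU(1) by (rule finite_subset) simp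
  obtain c :: "'k mpoly" where c: "c \<in> {1, - 1}" "specht \<nu> T = c * diff_prod ?A"
    using specht_eq_diff_prod[OF T \<nu>] by blast
  have cc: "c * c = 1" "c \<in> polys n" using c(1) by (auto intro: polys_uminus)
  have split: "(diff_prod (B \<union> C) :: 'k mpoly) = diff_prod B * diff_prod (C - B)"
    if "finite B" "finite C" for B C
  proof -
    have "diff_prod (B \<union> (C - B)) = (diff_prod B * diff_prod (C - B) :: 'k mpoly)"
      unfolding diff_prod_def using that by (intro prod.union_disjoint) auto
    then show ?thesis by (simp only: Un_Diff_cancel)
  qed
  have pol: "diff_prod (C - B) \<in> polys n" if "C \<subseteq> upper_pairs n" for B C
    using that by (intro polys_diff_prod) blast
  have "specht \<nu> T divides\<^bsub>poly_ring n\<^esub> (diff_prod (?A \<union> ?U) :: 'k mpoly)"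
    unfolding divides_poly_ring
  proof (rule bexI[of _ "c * diff_prod (?U - ?A)"])
    have "diff_prod (?A \<union> ?U) = (c * c) * (diff_prod ?A * diff_prod (?U - ?A))"
      by (simp add: cc split[OF fin])
    then show "diff_prod (?A \<union> ?U) = specht \<nu> T * (c * diff_prod (?U - ?A))"
      by (simp only: c(2) mult_ac)
  qed (intro polys_mult cc pol AU)
  moreover have "Delta m divides\<^bsub>poly_ring n\<^esub> (diff_prod (?A \<union> ?U) :: 'k mpoly)"
    unfolding divides_poly_ring
    using split[OF _ fin, of ?U] pol[OF AU(1), of ?U] by (simp add: Delta_eq_diff_prod Un_commute) blast
  moreover have "diff_prod (?A \<union> ?U) divides\<^bsub>poly_ring n\<^esub> y"
    if y: "y \<in> polys n" "specht \<nu> T divides\<^bsub>poly_ring n\<^esub> y" "Delta m divides\<^bsub>poly_ring n\<^esub> y" for y :: "'k mpoly"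
  proof -
    obtain p q where pq: "y = specht \<nu> T * p" "y = Delta m * q"
      using y(2,3) unfolding divides_poly_ring by blast
    have yy: "poly_eval \<alpha> y = poly_eval \<alpha> c * poly_eval \<alpha> (diff_prod ?A) * poly_eval \<alpha> p"
      "poly_eval \<alpha> y = poly_eval \<alpha> (diff_prod ?U) * poly_eval \<alpha> q" for \<alpha>
      by (subst pq(1), simp only: c(2) poly_eval_mult, subst pq(2), simp only: Delta_eq_diff_prod poly_eval_mult)
    have "poly_eval \<alpha> y = 0" if "(a, b) \<in> ?A \<union> ?U" "\<alpha> a = \<alpha> b" for \<alpha> a b
    proof (cases "(a, b) \<in> ?A")
      case True
      then have "poly_eval \<alpha> (diff_prod ?A) = 0"
        using that(2) poly_eval_diff_prod_eq_0[OF fin, of \<alpha>] by blast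
      then show ?thesis unfolding yy(1) by simp
    next
      case False
      then have "poly_eval \<alpha> (diff_prod ?U) = 0"
        using that poly_eval_diff_prod_eq_0[OF finite_upper_pairs, of \<alpha> m] by blast
      then show ?thesis unfolding yy(2) by simp
    qed
    then show ?thesis
      unfolding divides_poly_ring by (intro diff_prod_divides[OF inf AU(3) y(1)])
  qed
  ultimately show ?thesis unfolding islcm_def by blast
qed


lemma specht_lcm_properties:
  fixes T :: "nat \<times> nat \<Rightarrow> nat"
  assumes inf: "infinite (UNIV :: 'k::field set)" and T: "T \<in> Tab n l \<nu>" and \<nu>: "sorted_wrt (\<ge>) \<nu>"
    and n: "1 \<le> n" and m: "m \<le> n"
  shows "(specht_lcm n m \<nu> T :: 'k mpoly) \<in> polys n"
    and "(specht_lcm n m \<nu> T :: 'k mpoly) lcmof\<^bsub>poly_ring n\<^esub> (specht \<nu> T) (Delta m)"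
proof -
  let ?h = "diff_prod (column_pairs \<nu> T \<union> upper_pairs m) :: 'k mpoly"
  have "?h \<in> polys n"
    using column_pairs_upper[OF T n] upper_pairs_mono[OF m] by (intro polys_diff_prod) simp
  then have "\<exists>x. x \<in> polys n \<and> x lcmof\<^bsub>poly_ring n\<^esub> (specht \<nu> T :: 'k mpoly) (Delta m)"
    using diff_prod_lcm[OF inf T \<nu> n m] by blast
  from someI_ex[OF this] show "(specht_lcm n m \<nu> T :: 'k mpoly) \<in> polys n"
    "(specht_lcm n m \<nu> T :: 'k mpoly) lcmof\<^bsub>poly_ring n\<^esub> (specht \<nu> T) (Delta m)"
    unfolding specht_lcm_def somelcm_def by blast+
qed

text \<open>The chosen least common multiple divides the explicit one, so its leading monomial
  divides the explicit \<^const>\<open>weight\<close>. This direction of divisibility is what the comparison of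
  initial ideals requires.\<close>
lemma specht_lcm_leading_monomial:
  fixes T :: "nat \<times> nat \<Rightarrow> nat"
  assumes inf: "infinite (UNIV :: 'k::field set)" and T: "T \<in> Tab n l \<nu>" and \<nu>: "sorted_wrt (\<ge>) \<nu>"
    and n: "1 \<le> n" and m: "m \<le> n"
  shows "(specht_lcm n m \<nu> T :: 'k mpoly) \<noteq> 0"
    and "\<exists>u. weight (column_pairs \<nu> T \<union> upper_pairs m) = leading_monomial (specht_lcm n m \<nu> T :: 'k mpoly) + u"
proof -
  let ?A = "column_pairs \<nu> T \<union> upper_pairs m"
  let ?h = "diff_prod ?A :: 'k mpoly"
  let ?s = "specht_lcm n m \<nu> T :: 'k mpoly"
  have A: "?A \<subseteq> upper_pairs n" using column_pairs_upper[OF T n] upper_pairs_mono[OF m] by simp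
  have "?s divides\<^bsub>poly_ring n\<^esub> ?h"
    using specht_lcm_properties(2)[OF assms] diff_prod_lcm[OF inf T \<nu> n m] polys_diff_prod[OF A]
    unfolding islcm_def by blast
  then obtain q where q: "?h = ?s * q" unfolding divides_poly_ring by blast
  then have nz: "?s \<noteq> 0" "q \<noteq> 0" using diff_prod_nonzero[OF A, where 'k='k] by auto
  show "?s \<noteq> 0" by (rule nz)
  have "weight ?A = leading_monomial ?h"
    unfolding weight_def by (rule leading_monomial_diff_prod[OF A, symmetric])
  also have "\<dots> = leading_monomial ?s + leading_monomial q"
    unfolding q by (rule leading_monomial_mult[OF nz])
  finally show "\<exists>u. weight ?A = leading_monomial ?s + u" by (rule exI)
qed

lemma specht_lcm_vanishes:
  fixes T :: "nat \<times> nat \<Rightarrow> nat" and \<alpha> :: "nat \<Rightarrow> 'k::field"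
  assumes inf: "infinite (UNIV :: 'k set)" and T: "T \<in> Tab n l \<nu>" and n: "1 \<le> n" and l: "1 \<le> l" and m: "m \<le> n"
    and F: "excess_filter (n + l - 1) l F" and \<nu>: "\<nu> \<in> F" and vp: "vanishing_point n l m F \<alpha>"
  shows "poly_eval \<alpha> (specht_lcm n m \<nu> T) = 0"
proof -
  let ?s = "specht_lcm n m \<nu> T :: 'k mpoly"
  have srt: "sorted_wrt (\<ge>) \<nu>"
    using F \<nu> by (auto simp: excess_filter_def partitions_ge_def partitions_def)
  note lcm = specht_lcm_properties(2)[OF inf T srt n m]
  obtain p q where p: "?s = specht \<nu> T * p" and q: "?s = Delta m * q"
    using lcm unfolding islcm_def divides_poly_ring by blast
  show ?thesis
  proof (cases "\<exists>a b. (a, b) \<in> upper_pairs m \<and> \<alpha> a = \<alpha> b")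
    case True
    then have "poly_eval \<alpha> (diff_prod (upper_pairs m)) = 0"
      using poly_eval_diff_prod_eq_0[OF finite_upper_pairs, of \<alpha> m] by blast
    then show ?thesis unfolding q Delta_eq_diff_prod poly_eval_mult by simp
  next
    case False
    then have notF: "Lambda n l \<alpha> \<notin> F" using vp by (auto simp: vanishing_point_def)
    have fin: "finite (column_pairs \<nu> T)"
      using column_pairs_upper[OF T n] by (rule finite_subset) simp
    have "\<exists>a b. (a, b) \<in> column_pairs \<nu> T \<and> \<alpha> a = \<alpha> b"
    proof (rule ccontr)
      assume no: "\<not> (\<exists>a b. (a, b) \<in> column_pairs \<nu> T \<and> \<alpha> a = \<alpha> b)"
      have "excess (Lambda n l \<alpha>) t \<le> excess \<nu> t" for t
        by (rule excess_Lambda_le_excess_shape[OF T n]) (use no in blast)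
      then have "Lambda n l \<alpha> \<in> F"
        using F \<nu> Lambda_in_partitions_ge[OF n l] unfolding excess_filter_def by blast
      then show False using notF by simp
    qed
    then have "poly_eval \<alpha> (diff_prod (column_pairs \<nu> T)) = 0"
      using poly_eval_diff_prod_eq_0[OF fin, of \<alpha>] by blast
    moreover obtain c :: "'k mpoly" where "specht \<nu> T = c * diff_prod (column_pairs \<nu> T)"
      using specht_eq_diff_prod[OF T srt] by blast
    ultimately show ?thesis unfolding p by (simp add: poly_eval_mult)
  qed
qed

section \<open>The ideals\<close>

lemma poly_eval_cong:
  assumes "f \<in> polys n" "\<And>i. i \<in> {1..n} \<Longrightarrow> \<alpha> i = \<beta> i"
  shows "poly_eval \<alpha> f = poly_eval \<beta> f"
proof -
  have "monom_eval \<alpha> s = monom_eval \<beta> s" if "s \<in> keys f" for s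
    unfolding monom_eval_def using assms that by (intro prod.cong) (auto simp: mem_polys subset_eq)
  then show ?thesis by (simp add: poly_eval_superset[of "keys f"])
qed

lemma Lambda_cong:
  assumes "1 \<le> n" "\<And>i. i \<in> {1..n} \<Longrightarrow> \<alpha> i = \<beta> i"
  shows "Lambda n l \<alpha> = Lambda n l \<beta>"
proof -
  have "map \<alpha> [2..<Suc n] = map \<beta> [2..<Suc n]" using assms(2) by (intro map_cong) auto
  moreover have "\<alpha> 1 = \<beta> 1" using assms by simp
  ultimately have "word n l \<alpha> = word n l \<beta>" by (simp only: word_def)
  then show ?thesis by (simp only: Lambda_word)
qed

text \<open>Membership in \<open>(\<Delta>\<^sub>m)\<close> is itself a vanishing condition.\<close>
lemma Jm_ideal_eq:
  assumes inf: "infinite (UNIV :: 'k::field set)" and n: "1 \<le> n" and l: "1 \<le> l" and m: "m \<le> n"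
  shows "(Jm_ideal n l m (partitions_ge (n + l - 1) l - F) :: 'k mpoly set) =
    {f \<in> polys n. \<forall>\<alpha>. vanishing_point n l m F \<alpha> \<longrightarrow> poly_eval \<alpha> f = 0}" (is "?J = ?V")
proof
  let ?P = "partitions_ge (n + l - 1) l"
  have D: "(Delta m :: 'k mpoly) \<in> polys n"
    unfolding Delta_eq_diff_prod using upper_pairs_mono[OF m] by (rule polys_diff_prod)
  have PI: "PIdl\<^bsub>poly_ring n\<^esub> (Delta m :: 'k mpoly) = {q * Delta m | q. q \<in> polys n}"
    by (auto simp: cgenideal_def)
  show "?J \<subseteq> ?V"
  proof
    fix f :: "'k mpoly" assume f: "f \<in> ?J"
    then have J: "f \<in> polys n" "\<And>a. a \<in> {1..n} \<rightarrow>\<^sub>E UNIV \<Longrightarrow> Lambda n l a \<in> ?P - F \<Longrightarrow> poly_eval a f = 0"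
      by (simp_all add: Jm_ideal_def J_ideal_def)
    obtain q where q: "f = q * Delta m" using f unfolding Jm_ideal_def PI by blast
    have "poly_eval \<alpha> f = 0" if vp: "vanishing_point n l m F \<alpha>" for \<alpha>
    proof (cases "\<exists>a b. (a, b) \<in> upper_pairs m \<and> \<alpha> a = \<alpha> b")
      case True
      then have "poly_eval \<alpha> (diff_prod (upper_pairs m)) = 0"
        using poly_eval_diff_prod_eq_0[OF finite_upper_pairs, of \<alpha> m] by blast
      then show ?thesis unfolding q Delta_eq_diff_prod poly_eval_mult by simp
    next
      case False
      let ?\<beta> = "restrict \<alpha> {1..n}"
      have "Lambda n l ?\<beta> = Lambda n l \<alpha>" by (rule Lambda_cong[OF n]) simp
      moreover have "Lambda n l \<alpha> \<in> ?P - F"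
        using False vp Lambda_in_partitions_ge[OF n l] by (auto simp: vanishing_point_def)
      ultimately have "poly_eval ?\<beta> f = 0" by (intro J(2)) auto
      moreover have "poly_eval ?\<beta> f = poly_eval \<alpha> f" by (rule poly_eval_cong[OF J(1)]) simp
      ultimately show ?thesis by simp
    qed
    then show "f \<in> ?V" using J(1) by blast
  qed
  show "?V \<subseteq> ?J"
  proof
    fix f :: "'k mpoly" assume "f \<in> ?V"
    then have f: "f \<in> polys n" "\<And>\<alpha>. vanishing_point n l m F \<alpha> \<Longrightarrow> poly_eval \<alpha> f = 0" by blast+
    have "\<exists>q\<in>polys n. f = diff_prod (upper_pairs m) * q"
    proof (rule diff_prod_divides[OF inf upper_pairs_mono[OF m] f(1)])
      fix \<alpha> :: "nat \<Rightarrow> 'k" and a b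
      assume "(a, b) \<in> upper_pairs m" "\<alpha> a = \<alpha> b"
      then show "poly_eval \<alpha> f = 0" by (intro f(2)) (auto simp: vanishing_point_def)
    qed
    then obtain q where q: "q \<in> polys n" "f = q * Delta m"
      unfolding Delta_eq_diff_prod by (metis mult.commute)
    then have "f \<in> PIdl\<^bsub>poly_ring n\<^esub> (Delta m)" unfolding PI by blast
    moreover have "f \<in> J_ideal n l (?P - F)"
      unfolding J_ideal_def using f by (auto simp: vanishing_point_def)
    ultimately show "f \<in> ?J" by (simp add: Jm_ideal_def)
  qed
qed

lemma a_inv_poly_ring:
  assumes "f \<in> polys n"
  shows "\<ominus>\<^bsub>poly_ring n\<^esub> f = - f"
proof -
  interpret R: cring "poly_ring n" by (rule cring_poly_ring)
  show ?thesis by (rule R.minus_equality) (use assms polys_uminus in auto)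
qed

lemma ideal_poly_ringI:
  assumes "I \<subseteq> polys n" "0 \<in> I" "\<And>f g. f \<in> I \<Longrightarrow> g \<in> I \<Longrightarrow> f + g \<in> I"
    "\<And>f g. f \<in> I \<Longrightarrow> g \<in> polys n \<Longrightarrow> g * f \<in> I"
  shows "ideal I (poly_ring n)"
proof (rule idealI)
  interpret R: cring "poly_ring n" by (rule cring_poly_ring)
  show "ring (poly_ring n)" by (rule R.ring_axioms)
  show "subgroup I (add_monoid (poly_ring n))"
  proof (rule R.add.subgroupI)
    fix f assume f: "f \<in> I"
    have "- 1 * f \<in> I" using assms(4)[OF f polys_uminus[OF polys_one]] .
    moreover have "f \<in> polys n" using assms(1) f by blast
    ultimately show "\<ominus>\<^bsub>poly_ring n\<^esub> f \<in> I" by (simp add: a_inv_poly_ring)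
  qed (use assms in auto)
qed (use assms in \<open>auto simp: mult.commute\<close>)

lemma vanishing_ideal: "ideal {f \<in> polys n. \<forall>\<alpha>. P \<alpha> \<longrightarrow> poly_eval \<alpha> f = 0} (poly_ring n)"
  by (rule ideal_poly_ringI) (auto simp: poly_eval_add poly_eval_mult intro: polys_add polys_mult)

lemma radical_vanishing_ideal:
  "radical_ideal {f \<in> polys n. \<forall>\<alpha>. P \<alpha> \<longrightarrow> poly_eval \<alpha> f = 0} (poly_ring n)"
  unfolding radical_ideal_def using vanishing_ideal[of n P]
  by (auto simp: nat_pow_poly_ring poly_eval_power)

section \<open>Groebner bases\<close>

lemma lookup_single_mult: "lookup (single u c * g) (u + t) = c * lookup (g :: 'k::field mpoly) t"
proof -
  have "single u c * g = (\<Sum>s\<in>keys g. single (u + s) (c * lookup g s))"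
    by (subst poly_as_sum[of g]) (simp only: sum_distrib_left mult_single)
  then show ?thesis by (simp add: lookup_sum lookup_single when_def in_keys_iff)
qed

lemma keys_add_right: "keys (u :: nat \<Rightarrow>\<^sub>0 nat) \<subseteq> keys (s + u)"
  by (auto simp: in_keys_iff lookup_add)

lemma keys_leading_monomial:
  assumes "f \<in> polys n" "f \<noteq> 0"
  shows "keys (leading_monomial f) \<subseteq> {1..n}"
  using assms leading_monomial_in_keys[of f] by (simp add: mem_polys)

lemma initial_ideal_eq:
  fixes J :: "'k::field mpoly set"
  assumes J: "J \<subseteq> polys n" and G: "G \<subseteq> J"
    and div: "\<And>f. f \<in> J \<Longrightarrow> f \<noteq> 0 \<Longrightarrow> \<exists>g\<in>G. g \<noteq> 0 \<and> (\<exists>u. leading_monomial f = leading_monomial g + u)"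
  shows "initial_ideal n G = initial_ideal n J"
proof -
  interpret R: cring "poly_ring n :: 'k mpoly ring" by (rule cring_poly_ring)
  let ?L = "\<lambda>A. {single (leading_monomial f) (1 :: 'k) | f. f \<in> A \<and> f \<noteq> 0}"
  have L: "?L J \<subseteq> polys n" using J by (auto intro!: polys_single[OF keys_leading_monomial])
  have LG: "?L G \<subseteq> ?L J" using G by blast
  have LG': "?L G \<subseteq> polys n" using L LG by (rule order_trans[rotated])
  have idG: "ideal (Idl\<^bsub>poly_ring n\<^esub> (?L G)) (poly_ring n)" by (rule R.genideal_ideal[OF LG'])
  have "?L J \<subseteq> Idl\<^bsub>poly_ring n\<^esub> (?L G)"
  proof
    fix x assume "x \<in> ?L J"
    then obtain f where f: "f \<in> J" "f \<noteq> 0" "x = single (leading_monomial f) 1" by blast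
    obtain g u where g: "g \<in> G" "g \<noteq> 0" "leading_monomial f = leading_monomial g + u"
      using div[OF f(1,2)] by blast
    have "keys u \<subseteq> {1..n}"
      using keys_leading_monomial[of f n] f(1,2) J keys_add_right[of u "leading_monomial g"] g(3) by auto
    then have "single u (1 :: 'k) \<in> polys n" by (rule polys_single)
    moreover have "single (leading_monomial g) 1 \<in> Idl\<^bsub>poly_ring n\<^esub> (?L G)"
      using R.genideal_self[OF LG'] g(1,2) by blast
    ultimately have "single u 1 * single (leading_monomial g) 1 \<in> Idl\<^bsub>poly_ring n\<^esub> (?L G)"
      using ideal.I_l_closed[OF idG] by simp
    then show "x \<in> Idl\<^bsub>poly_ring n\<^esub> (?L G)"
      by (simp add: f(3) g(3) mult_single add.commute)
  qed
  then have "Idl\<^bsub>poly_ring n\<^esub> (?L J) \<subseteq> Idl\<^bsub>poly_ring n\<^esub> (?L G)"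
    by (rule R.genideal_minimal[OF idG])
  moreover have "Idl\<^bsub>poly_ring n\<^esub> (?L G) \<subseteq> Idl\<^bsub>poly_ring n\<^esub> (?L J)"
    using LG R.genideal_self[OF L] by (intro R.genideal_minimal[OF R.genideal_ideal[OF L]]) (rule order_trans)
  ultimately show ?thesis unfolding initial_ideal_def by (rule equalityI[rotated])
qed

text \<open>The division algorithm: subtracting a multiple of an element of \<open>G\<close> cancels the leading
  term and leaves a polynomial in \<open>J\<close> with a smaller leading monomial.\<close>
lemma ideal_generated_by_leading:
  fixes J :: "'k::field mpoly set"
  assumes J: "ideal J (poly_ring n)" and G: "G \<subseteq> J"
    and div: "\<And>f. f \<in> J \<Longrightarrow> f \<noteq> 0 \<Longrightarrow> \<exists>g\<in>G. g \<noteq> 0 \<and> (\<exists>u. leading_monomial f = leading_monomial g + u)"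
  shows "J = Idl\<^bsub>poly_ring n\<^esub> G"
proof
  interpret R: cring "poly_ring n :: 'k mpoly ring" by (rule cring_poly_ring)
  interpret J: ideal J "poly_ring n" by (rule J)
  have JP: "J \<subseteq> polys n" by (rule J.a_subset)
  have GP: "G \<subseteq> polys n" using G JP by (rule order_trans)
  interpret I: ideal "Idl\<^bsub>poly_ring n\<^esub> G" "poly_ring n" by (rule R.genideal_ideal[OF GP])
  show "Idl\<^bsub>poly_ring n\<^esub> G \<subseteq> J" by (rule R.genideal_minimal[OF J G])
  have "f \<in> Idl\<^bsub>poly_ring n\<^esub> G" if "f \<in> J" "f \<noteq> 0" "leading_monomial f = s" for f s
    using that
  proof (induction s arbitrary: f rule: wf_induct_rule[OF wf_lex_less[of n]])
    case (1 s f)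
    obtain g u where g: "g \<in> G" "g \<noteq> 0" "leading_monomial f = leading_monomial g + u"
      using div[OF 1(2,3)] by blast
    have fP: "f \<in> polys n" and gP: "g \<in> polys n" using 1(2) g(1) JP GP by auto
    define c where "c = lookup f s / lookup g (leading_monomial g)"
    define p where "p = single u c * g"
    define f' where "f' = f - p"
    have gl: "lookup g (leading_monomial g) \<noteq> 0"
      using leading_monomial_in_keys[OF g(2)] by (simp add: in_keys_iff)
    have s: "s = u + leading_monomial g" using g(3) 1(4) by (simp add: add.commute)
    have "keys u \<subseteq> {1..n}"
      using keys_leading_monomial[OF fP 1(3)] keys_add_right[of u "leading_monomial g"] g(3) by simp
    then have uP: "single u c \<in> polys n" by (rule polys_single)
    have pI: "p \<in> Idl\<^bsub>poly_ring n\<^esub> G"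
      using I.I_l_closed[of g "single u c"] uP R.genideal_self[OF GP] g(1) by (auto simp: p_def)
    have pJ: "p \<in> J" using J.I_l_closed[of g "single u c"] uP G g(1) by (auto simp: p_def)
    have "- p \<in> J"
      using J.a_inv_closed[OF pJ] a_inv_poly_ring[of p n] pJ JP by auto
    then have f'J: "f' \<in> J" using J.a_closed[OF 1(2), of "- p"] by (simp add: f'_def)
    have f': "f' \<in> Idl\<^bsub>poly_ring n\<^esub> G"
    proof (cases "f' = 0")
      case True
      then show ?thesis using I.zero_closed by simp
    next
      case False
      let ?t = "leading_monomial f'"
      have t: "?t \<in> keys f'" by (rule leading_monomial_in_keys[OF False])
      have "lookup p s = lookup f s"
        using gl unfolding s p_def lookup_single_mult by (simp add: c_def s)
      then have ts: "?t \<noteq> s" using t by (auto simp: in_keys_iff f'_def lookup_minus)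
      have "?t \<in> keys f \<or> ?t \<in> keys p"
        using t by (auto simp: in_keys_iff f'_def lookup_minus)
      then have "lex_less ?t s"
      proof
        assume "?t \<in> keys f"
        then show ?thesis
          using is_leading_leading_monomial[OF 1(3)] ts 1(4) by (simp add: is_leading_def)
      next
        assume tp: "?t \<in> keys p"
        have "c \<noteq> 0" using tp by (auto simp: p_def)
        then have "is_leading p s"
          unfolding p_def s
          by (intro is_leading_mult is_leading_leading_monomial[OF g(2)]) (simp add: is_leading_def)
        then show ?thesis using tp ts by (simp add: is_leading_def)
      qed
      moreover have "keys ?t \<subseteq> {1..n}" using f'J JP False by (intro keys_leading_monomial) auto
      moreover have "keys s \<subseteq> {1..n}" using keys_leading_monomial[OF fP 1(3)] 1(4) by simp
      ultimately show ?thesis using 1(1)[of ?t f'] f'J False by simp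
    qed
    have "f' + p \<in> Idl\<^bsub>poly_ring n\<^esub> G" using I.a_closed[OF f' pI] by simp
    then show ?case by (simp add: f'_def)
  qed
  then show "J \<subseteq> Idl\<^bsub>poly_ring n\<^esub> G" using I.zero_closed by fastforce
qed

theorem theorem4p3:
  fixes n l m :: nat and F :: "nat list set"
  assumes "infinite (UNIV :: 'k::field set)"
    and "1 \<le> n" and "1 \<le> l" and "1 \<le> m" and "m \<le> n"
    and "lower_filter (n + l - 1) l F"
    and "F \<subset> partitions_ge (n + l - 1) l"
  shows "groebner_basis n (G_set n l m F)
           (Jm_ideal n l m (partitions_ge (n + l - 1) l - F) :: 'k mpoly set) \<and>
         (Jm_ideal n l m (partitions_ge (n + l - 1) l - F) :: 'k mpoly set) = I_ideal n l m F \<and>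
         radical_ideal (I_ideal n l m F :: 'k mpoly set) (poly_ring n)"
proof -
  note inf = assms(1) and n = assms(2) and l = assms(3) and m = assms(5)
  let ?J = "Jm_ideal n l m (partitions_ge (n + l - 1) l - F) :: 'k mpoly set"
  let ?G = "G_set n l m F :: 'k mpoly set"
  have F: "excess_filter (n + l - 1) l F" by (rule excess_filter_if_lower_filter[OF assms(6)])
  have srt: "sorted_wrt (\<ge>) \<nu>" if "\<nu> \<in> F" for \<nu>
    using assms(7) that by (auto simp: partitions_ge_def partitions_def)
  note J = Jm_ideal_eq[OF inf n l m, of F]
  have idJ: "ideal ?J (poly_ring n)" unfolding J by (rule vanishing_ideal)
  have GJ: "?G \<subseteq> ?J"
  proof
    fix g assume "g \<in> ?G"
    then obtain \<nu> T where g: "g = specht_lcm n m \<nu> T" "\<nu> \<in> F" "T \<in> Tab n l \<nu>"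
      unfolding G_set_def by blast
    have "g \<in> polys n" unfolding g(1) by (rule specht_lcm_properties(1)[OF inf g(3) srt[OF g(2)] n m])
    moreover have "poly_eval \<alpha> g = 0" if "vanishing_point n l m F \<alpha>" for \<alpha>
      unfolding g(1) by (rule specht_lcm_vanishes[OF inf g(3) n l m F g(2) that])
    ultimately show "g \<in> ?J" unfolding J by blast
  qed
  have G0: "0 \<notin> ?G"
  proof
    assume "0 \<in> ?G"
    then obtain \<nu> T where g: "(0 :: 'k mpoly) = specht_lcm n m \<nu> T" "\<nu> \<in> F" "T \<in> Tab n l \<nu>"
      unfolding G_set_def by blast
    show False using specht_lcm_leading_monomial(1)[OF inf g(3) srt[OF g(2)] n m] g(1) by simp
  qed
  have finG: "finite ?G"
  proof -
    have "finite F"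
    proof (rule finite_subset[OF _ finite_partitions])
      show "F \<subseteq> partitions (n + l - 1)" using assms(7) by (auto simp: partitions_ge_def)
    qed
    then have fin: "finite (\<Union>\<nu>\<in>F. specht_lcm n m \<nu> ` Tab n l \<nu> :: 'k mpoly set)"
      using finite_Tab[OF n] by (intro finite_UN_I finite_imageI)
    show ?thesis by (rule finite_subset[OF _ fin]) (auto simp: G_set_def)
  qed
  have div: "\<exists>g\<in>?G. g \<noteq> 0 \<and> (\<exists>u. leading_monomial f = leading_monomial g + u)"
    if f: "f \<in> ?J" "f \<noteq> 0" for f
  proof -
    have "f \<in> polys n" and van: "\<And>\<alpha>. vanishing_point n l m F \<alpha> \<Longrightarrow> poly_eval \<alpha> f = 0"
      using f(1) unfolding J by blast+
    then obtain \<nu> T u where \<nu>: "\<nu> \<in> F" and T: "T \<in> Tab n l \<nu>"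
      and u: "leading_monomial f = weight (column_pairs \<nu> T \<union> upper_pairs m) + u"
      using leading_monomial_divisible[OF inf l assms(4) m F _ f(2)] by blast
    let ?g = "specht_lcm n m \<nu> T :: 'k mpoly"
    note lm = specht_lcm_leading_monomial[OF inf T srt[OF \<nu>] n m]
    obtain w where w: "weight (column_pairs \<nu> T \<union> upper_pairs m) = leading_monomial ?g + w"
      using lm(2) by (rule exE)
    show ?thesis
    proof (rule bexI[of _ ?g], intro conjI exI)
      show "leading_monomial f = leading_monomial ?g + (w + u)"
        unfolding u w by (rule add.assoc)
      show "?g \<in> ?G" using \<nu> T unfolding G_set_def by blast
    qed (rule lm(1))
  qed
  have JP: "?J \<subseteq> polys n" unfolding J by blast
  have "groebner_basis n ?G ?J"
    unfolding groebner_basis_def using idJ finG GJ G0 initial_ideal_eq[OF JP GJ div] by blast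
  moreover have eq: "?J = I_ideal n l m F"
    unfolding I_ideal_def by (rule ideal_generated_by_leading[OF idJ GJ div])
  moreover have "radical_ideal (I_ideal n l m F :: 'k mpoly set) (poly_ring n)"
    unfolding eq[symmetric] J by (rule radical_vanishing_ideal)
  ultimately show ?thesis by blast
qed

end
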